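(* Let $n\in\mathbb N$ and let $\mu$ be Lebesgue measure on $[0,1]^n$. The normed space $(L^1(\mu)_u,s_\mu)$ is a state-complete Riesz MV-algebra. Moreover, $(L^1(\mu)_u,s_\mu)$ is, up to isomorphism, the norm-completion of the normed space $(RL_n,I)$.
   Context: An MV-algebra is a structure $(A,\oplus,{}^*,0)$ with $(A,\oplus,0)$ an Abelian monoid, $x^{**}=x$, $(x^*\oplus y)^*\oplus y=(y^*\oplus x)^*\oplus x$, $0^*\oplus x=0^*$; $1=0^*$, $x\odot y=(x^*\oplus y^* )^*$. A Riesz MV-algebra is an MV-algebra with unary operations $x\mapsto rx$, $r\in[0,1]$, satisfying $r(x\odot y^* )=(rx)\odot(ry)^*$, $(r\odot q^* )x=(rx)\odot(qx)^*$, $r(qx)=(rq)x$, $1x=x$ (with $r\odot q^*=\max(0,r-q)$ for reals). A state on an MV-algebra (or Riesz MV-algebra) $A$ is a map $s:A\to[0,1]$ with $s(1)=1$ and $s(x\oplus y)=s(x)+s(y)$ whenever $x\odot y=0$. It induces the pseudometric $\rho_s(x,y)=s((x\odot y^* )\oplus(x^*\odot y))$. $(R,s)$ is state-complete if $(R,\rho_s)$ is a complete metric space. The norm-completion of $(R,s)$ is its Cauchy completion with respect to $\rho_s$, with operations and state extended by continuity. $RL_n$ is the Lindenbaum–Tarski algebra in $n$ variables of the logic $\mathcal R\text{Ł}$ (Łukasiewicz logic with additional unary connectives $\nabla_r$, $r\in[0,1]$, interpreted in $[0,1]$ by $x\mapsto 1-r(1-x)$); via $[\varphi]\mapsto f_\varphi$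 (the term function of $\varphi$) it is identified with the Riesz MV-algebra $RMV_n$ of all continuous functions $f:[0,1]^n\to[0,1]$ that are piecewise linear with real coefficients (i.e. there are finitely many affine functions $f_1,\dots,f_m:\mathbb R^n\to\mathbb R$ with $f(\mathbf x)\in\{f_1(\mathbf x),\dots,f_m(\mathbf x)\}$ for all $\mathbf x$), with pointwise operations $f\oplus g=\min(1,f+g)$, $f^*=1-f$, $rf$. The state $I$ on $RL_n$ is $I([\varphi])=\int_{[0,1]^n}f_\varphi(\mathbf x)\,d\mathbf x$. $L^1(\mu)_u$ is the algebra of classes $\hat f$, modulo equality $\mu$-almost everywhere, of integrable functions $f:[0,1]^n\to[0,1]$, with pointwise operations $\min(1,f+g)$, $1-f$, $rf$, and $s_\mu(\hat f)=\int f\,d\mu$. *)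

theory Defs
  imports "HOL-Analysis.Analysis"
begin

section \<open>Scalars\<close>

typedef unit_real = "{0..1::real}"
  morphisms of_unit Abs_unit
  by (rule exI[of _ 0]) simp

setup_lifting type_definition_unit_real

instantiation unit_real :: "{one, times}"
begin

lift_definition one_unit_real :: unit_real is 1
  by simp

lift_definition times_unit_real :: "unit_real \<Rightarrow> unit_real \<Rightarrow> unit_real" is "(*)"
  by (auto intro: mult_le_one)

instance ..

end

text \<open>\<open>r \<odot> q\<^sup>*\<close> for scalars.\<close>

lift_definition unit_diff :: "unit_real \<Rightarrow> unit_real \<Rightarrow> unit_real"
  is "\<lambda>r q. max 0 (r - q)"
  by auto


section \<open>Riesz MV-algebras\<close>

record 'a riesz_mv =
  carrier :: "'a set"
  mv_plus :: "'a \<Rightarrow> 'a \<Rightarrow> 'a"  (infixl "\<oplus>\<index>" 65)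
  mv_neg :: "'a \<Rightarrow> 'a"  ("\<ominus>\<index> _" [81] 80)
  mv_zero :: 'a  ("\<zero>\<index>")
  mv_scale :: "unit_real \<Rightarrow> 'a \<Rightarrow> 'a"

definition mv_mult :: "('a, 'm) riesz_mv_scheme \<Rightarrow> 'a \<Rightarrow> 'a \<Rightarrow> 'a"  (infixl "\<odot>\<index>" 70)
  where "x \<odot>\<^bsub>A\<^esub> y = \<ominus>\<^bsub>A\<^esub> ((\<ominus>\<^bsub>A\<^esub> x) \<oplus>\<^bsub>A\<^esub> (\<ominus>\<^bsub>A\<^esub> y))"

definition mv_one :: "('a, 'm) riesz_mv_scheme \<Rightarrow> 'a"  ("\<one>\<index>")
  where "\<one>\<^bsub>A\<^esub> = \<ominus>\<^bsub>A\<^esub> \<zero>\<^bsub>A\<^esub>"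

locale mv_algebra =
  fixes A :: "('a, 'm) riesz_mv_scheme" (structure)
  assumes plus_closed: "x \<in> carrier A \<Longrightarrow> y \<in> carrier A \<Longrightarrow> x \<oplus> y \<in> carrier A"
    and neg_closed: "x \<in> carrier A \<Longrightarrow> \<ominus> x \<in> carrier A"
    and zero_closed: "\<zero> \<in> carrier A"
    and plus_assoc: "x \<in> carrier A \<Longrightarrow> y \<in> carrier A \<Longrightarrow> z \<in> carrier A
      \<Longrightarrow> (x \<oplus> y) \<oplus> z = x \<oplus> (y \<oplus> z)"
    and plus_commute: "x \<in> carrier A \<Longrightarrow> y \<in> carrier A \<Longrightarrow> x \<oplus> y = y \<oplus> x"
    and plus_zero: "x \<in> carrier A \<Longrightarrow> x \<oplus> \<zero> = x"
    and neg_neg: "x \<in> carrier A \<Longrightarrow> \<ominus> (\<ominus> x) = x"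
    and lukasiewicz: "x \<in> carrier A \<Longrightarrow> y \<in> carrier A
      \<Longrightarrow> (\<ominus> ((\<ominus> x) \<oplus> y)) \<oplus> y = (\<ominus> ((\<ominus> y) \<oplus> x)) \<oplus> x"
    and neg_zero_plus: "x \<in> carrier A \<Longrightarrow> (\<ominus> \<zero>) \<oplus> x = \<ominus> \<zero>"

locale riesz_mv_algebra = mv_algebra +
  assumes scale_closed: "x \<in> carrier A \<Longrightarrow> mv_scale A r x \<in> carrier A"
    and scale_mult_neg: "x \<in> carrier A \<Longrightarrow> y \<in> carrier A
      \<Longrightarrow> mv_scale A r (x \<odot> (\<ominus> y)) = mv_scale A r x \<odot> (\<ominus> (mv_scale A r y))"
    and unit_diff_scale: "x \<in> carrier A
      \<Longrightarrow> mv_scale A (unit_diff r q) x = mv_scale A r x \<odot> (\<ominus> (mv_scale A q x))"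
    and scale_scale: "x \<in> carrier A \<Longrightarrow> mv_scale A r (mv_scale A q x) = mv_scale A (r * q) x"
    and one_scale: "x \<in> carrier A \<Longrightarrow> mv_scale A 1 x = x"


section \<open>States, state-completeness and norm-completion\<close>

definition mv_state :: "('a, 'm) riesz_mv_scheme \<Rightarrow> ('a \<Rightarrow> real) \<Rightarrow> bool"
  where "mv_state A s \<longleftrightarrow>
    s \<in> carrier A \<rightarrow> {0..1} \<and> s \<one>\<^bsub>A\<^esub> = 1 \<and>
    (\<forall>x\<in>carrier A. \<forall>y\<in>carrier A. x \<odot>\<^bsub>A\<^esub> y = \<zero>\<^bsub>A\<^esub> \<longrightarrow> s (x \<oplus>\<^bsub>A\<^esub> y) = s x + s y)"

text \<open>The value off the carrier only serves the library locale \<^locale>\<open>Metric_space\<close>, which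
  demands nonnegativity and symmetry of a distance on the whole type.\<close>

definition state_dist :: "('a, 'm) riesz_mv_scheme \<Rightarrow> ('a \<Rightarrow> real) \<Rightarrow> 'a \<Rightarrow> 'a \<Rightarrow> real"
  where "state_dist A s x y =
    (if x \<in> carrier A \<and> y \<in> carrier A
     then s ((x \<odot>\<^bsub>A\<^esub> (\<ominus>\<^bsub>A\<^esub> y)) \<oplus>\<^bsub>A\<^esub> ((\<ominus>\<^bsub>A\<^esub> x) \<odot>\<^bsub>A\<^esub> y))
     else 0)"

definition state_complete :: "('a, 'm) riesz_mv_scheme \<Rightarrow> ('a \<Rightarrow> real) \<Rightarrow> bool"
  where "state_complete A s \<longleftrightarrow>
    Metric_space (carrier A) (state_dist A s) \<and>
    Metric_space.mcomplete (carrier A) (state_dist A s)"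

text \<open>The norm-completion consists of the classes of Cauchy sequences modulo null distance. The
  operations and the state are (uniformly) continuous for the pseudometric, so their continuous
  extensions are computed termwise on representatives. A Cauchy criterion is spelled out because
  the pseudometric need not separate points, as \<^locale>\<open>Metric_space\<close> would require.\<close>

definition cauchy_seqs :: "('a, 'm) riesz_mv_scheme \<Rightarrow> ('a \<Rightarrow> real) \<Rightarrow> (nat \<Rightarrow> 'a) set"
  where "cauchy_seqs A s =
    {x. range x \<subseteq> carrier A \<and>
        (\<forall>\<epsilon>>0. \<exists>N. \<forall>j\<ge>N. \<forall>k\<ge>N. state_dist A s (x j) (x k) < \<epsilon>)}"

definition cauchy_rel :: "('a, 'm) riesz_mv_scheme \<Rightarrow> ('a \<Rightarrow> real) \<Rightarrow> (nat \<Rightarrow> 'a) rel"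
  where "cauchy_rel A s =
    {(x, y). x \<in> cauchy_seqs A s \<and> y \<in> cauchy_seqs A s \<and>
             (\<lambda>i. state_dist A s (x i) (y i)) \<longlonglongrightarrow> 0}"

definition norm_completion ::
    "('a, 'm) riesz_mv_scheme \<Rightarrow> ('a \<Rightarrow> real) \<Rightarrow> (nat \<Rightarrow> 'a) set riesz_mv"
  where "norm_completion A s =
    \<lparr>carrier = cauchy_seqs A s // cauchy_rel A s,
     mv_plus = (\<lambda>X Y. \<Union>x\<in>X. \<Union>y\<in>Y. cauchy_rel A s `` {\<lambda>i. x i \<oplus>\<^bsub>A\<^esub> y i}),
     mv_neg = (\<lambda>X. \<Union>x\<in>X. cauchy_rel A s `` {\<lambda>i. \<ominus>\<^bsub>A\<^esub> (x i)}),
     mv_zero = cauchy_rel A s `` {\<lambda>i. \<zero>\<^bsub>A\<^esub>},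
     mv_scale = (\<lambda>r X. \<Union>x\<in>X. cauchy_rel A s `` {\<lambda>i. mv_scale A r (x i)})\<rparr>"

definition completion_state :: "('a \<Rightarrow> real) \<Rightarrow> (nat \<Rightarrow> 'a) set \<Rightarrow> real"
  where "completion_state s X = (THE c. \<forall>x\<in>X. (\<lambda>i. s (x i)) \<longlonglongrightarrow> c)"

definition normed_isomorphic ::
    "('a, 'm) riesz_mv_scheme \<Rightarrow> ('a \<Rightarrow> real) \<Rightarrow> ('b, 'k) riesz_mv_scheme \<Rightarrow> ('b \<Rightarrow> real) \<Rightarrow> bool"
  where "normed_isomorphic A s B t \<longleftrightarrow>
    (\<exists>h. bij_betw h (carrier A) (carrier B) \<and>
      (\<forall>x\<in>carrier A. \<forall>y\<in>carrier A. h (x \<oplus>\<^bsub>A\<^esub> y) = h x \<oplus>\<^bsub>B\<^esub> h y) \<and>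
      (\<forall>x\<in>carrier A. h (\<ominus>\<^bsub>A\<^esub> x) = \<ominus>\<^bsub>B\<^esub> (h x)) \<and>
      h \<zero>\<^bsub>A\<^esub> = \<zero>\<^bsub>B\<^esub> \<and>
      (\<forall>r. \<forall>x\<in>carrier A. h (mv_scale A r x) = mv_scale B r (h x)) \<and>
      (\<forall>x\<in>carrier A. t (h x) = s x))"


section \<open>The algebra of classes of integrable functions\<close>

definition unit_integrable :: "'x measure \<Rightarrow> ('x \<Rightarrow> real) set"
  where "unit_integrable M = {f. integrable M f \<and> f \<in> space M \<rightarrow> {0..1}}"

definition ae_rel :: "'x measure \<Rightarrow> ('x \<Rightarrow> real) rel"
  where "ae_rel M =
    {(f, g). f \<in> unit_integrable M \<and> g \<in> unit_integrable M \<and> (AE x in M. f x = g x)}"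

definition L1_unit :: "'x measure \<Rightarrow> ('x \<Rightarrow> real) set riesz_mv"
  where "L1_unit M =
    \<lparr>carrier = unit_integrable M // ae_rel M,
     mv_plus = (\<lambda>F G. \<Union>f\<in>F. \<Union>g\<in>G. ae_rel M `` {\<lambda>x. min 1 (f x + g x)}),
     mv_neg = (\<lambda>F. \<Union>f\<in>F. ae_rel M `` {\<lambda>x. 1 - f x}),
     mv_zero = ae_rel M `` {\<lambda>x. 0},
     mv_scale = (\<lambda>r F. \<Union>f\<in>F. ae_rel M `` {\<lambda>x. of_unit r * f x})\<rparr>"

definition L1_state :: "'x measure \<Rightarrow> ('x \<Rightarrow> real) set \<Rightarrow> real"
  where "L1_state M F = (THE c. \<forall>f\<in>F. c = (\<integral>x. f x \<partial>M))"

definition cube_measure :: "(real ^ 'n) measure"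
  where "cube_measure = lebesgue_on (cbox 0 1)"


section \<open>The logic and its Lindenbaum--Tarski algebra\<close>

datatype 'v form = Var 'v | Neg "'v form" | Imp "'v form" "'v form" | Nabla unit_real "'v form"

text \<open>Lukasiewicz's axioms for \<^const>\<open>Imp\<close> and \<^const>\<open>Neg\<close>, and the four axiom schemes of Di Nola
  and Leustean for the connectives \<open>\<nabla>\<^sub>r\<close>, each an equivalence split into its two implications. The
  latter are the De Morgan duals, under \<open>\<nabla>\<^sub>r x = (r x\<^sup>*)\<^sup>*\<close>, of the four axioms for scalars in
  \<^locale>\<open>riesz_mv_algebra\<close>. Modus ponens is the only rule.\<close>

inductive provable :: "'v form \<Rightarrow> bool"  ("\<turnstile> _" [60] 60)
  where
    L1: "\<turnstile> Imp a (Imp b a)"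
  | L2: "\<turnstile> Imp (Imp a b) (Imp (Imp b c) (Imp a c))"
  | L3: "\<turnstile> Imp (Imp (Imp a b) b) (Imp (Imp b a) a)"
  | L4: "\<turnstile> Imp (Imp (Neg a) (Neg b)) (Imp b a)"
  | R1: "\<turnstile> Imp (Nabla r (Imp a b)) (Imp (Nabla r a) (Nabla r b))"
  | R1': "\<turnstile> Imp (Imp (Nabla r a) (Nabla r b)) (Nabla r (Imp a b))"
  | R2: "\<turnstile> Imp (Nabla (unit_diff r q) a) (Imp (Nabla q a) (Nabla r a))"
  | R2': "\<turnstile> Imp (Imp (Nabla q a) (Nabla r a)) (Nabla (unit_diff r q) a)"
  | R3: "\<turnstile> Imp (Nabla r (Nabla q a)) (Nabla (r * q) a)"
  | R3': "\<turnstile> Imp (Nabla (r * q) a) (Nabla r (Nabla q a))"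
  | R4: "\<turnstile> Imp (Nabla 1 a) a"
  | R4': "\<turnstile> Imp a (Nabla 1 a)"
  | MP: "\<turnstile> a \<Longrightarrow> \<turnstile> Imp a b \<Longrightarrow> \<turnstile> b"

lemma Imp_trans: "\<turnstile> Imp a b \<Longrightarrow> \<turnstile> Imp b c \<Longrightarrow> \<turnstile> Imp a c"
  by (meson L2 MP)

lemma Imp_refl: "\<turnstile> Imp a a"
proof -
  obtain t :: "'a form" where t: "\<turnstile> t"
    using L1 by blast
  have "\<turnstile> Imp (Imp a t) t \<Longrightarrow> \<turnstile> Imp (Imp t a) a"
    by (meson L3 MP)
  moreover have "\<turnstile> Imp (Imp a t) t"
    by (meson t L1 MP)
  ultimately show ?thesis
    by (meson L1 Imp_trans)
qed

lemma Imp_exchange: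
  assumes "\<turnstile> Imp a (Imp b c)"
  shows "\<turnstile> Imp b (Imp a c)"
proof -
  have "\<turnstile> Imp b (Imp (Imp b c) c)"
    by (meson L1 L3 Imp_trans)
  moreover have "\<turnstile> Imp (Imp (Imp b c) c) (Imp a c)"
    by (meson assms L2 MP)
  ultimately show ?thesis
    by (rule Imp_trans)
qed

lemma Imp_mono:
  assumes "\<turnstile> Imp a' a" and "\<turnstile> Imp b b'"
  shows "\<turnstile> Imp (Imp a b) (Imp a' b')"
proof -
  have "\<turnstile> Imp (Imp a b) (Imp a' b)"
    by (meson assms(1) L2 MP)
  moreover have "\<turnstile> Imp (Imp a' b) (Imp a' b')"
    by (meson assms(2) L2 MP Imp_exchange)
  ultimately show ?thesis
    by (rule Imp_trans)
qed

lemma Neg_Neg_elim: "\<turnstile> Imp (Neg (Neg a)) a"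
proof -
  obtain t :: "'a form" where t: "\<turnstile> t"
    using L1 by blast
  have "\<turnstile> Imp (Neg (Neg a)) (Imp t a)"
    by (meson L1 L4 Imp_trans)
  then show ?thesis
    by (meson t Imp_exchange MP)
qed

lemma Neg_antimono:
  assumes "\<turnstile> Imp a b"
  shows "\<turnstile> Imp (Neg b) (Neg a)"
proof -
  have "\<turnstile> Imp b (Neg (Neg b))"
    by (meson Neg_Neg_elim L4 MP)
  then have "\<turnstile> Imp (Neg (Neg a)) (Neg (Neg b))"
    by (meson assms Neg_Neg_elim Imp_trans)
  then show ?thesis
    by (meson L4 MP)
qed

lemma unit_diff_self: "unit_diff r r = unit_diff 1 1"
  by transfer simp

lemma unit_diff_one: "unit_diff r 1 = unit_diff 1 1"
  by transfer simp

lemma Nabla_necessitation: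
  assumes "\<turnstile> a"
  shows "\<turnstile> Nabla r a"
proof -
  have "\<turnstile> Nabla (unit_diff r 1) a"
    by (metis R2' Imp_refl MP unit_diff_self unit_diff_one)
  then have "\<turnstile> Imp (Nabla 1 a) (Nabla r a)"
    by (meson R2 MP)
  then show ?thesis
    by (meson assms R4' MP)
qed

lemma Nabla_mono: "\<turnstile> Imp a b \<Longrightarrow> \<turnstile> Imp (Nabla r a) (Nabla r b)"
  by (meson Nabla_necessitation R1 MP)

definition equiprovable :: "'v form \<Rightarrow> 'v form \<Rightarrow> bool"
  where "equiprovable a b \<longleftrightarrow> \<turnstile> Imp a b \<and> \<turnstile> Imp b a"

quotient_type 'v lindenbaum = "'v form" / equiprovable
  unfolding equiprovable_def
  by (intro equivpI reflpI sympI transpI) (auto intro: Imp_refl Imp_trans)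

lift_definition lind_plus :: "'v lindenbaum \<Rightarrow> 'v lindenbaum \<Rightarrow> 'v lindenbaum"
  is "\<lambda>a b. Imp (Neg a) b"
  by (auto simp: equiprovable_def intro: Imp_mono Neg_antimono)

lift_definition lind_neg :: "'v lindenbaum \<Rightarrow> 'v lindenbaum" is Neg
  by (auto simp: equiprovable_def intro: Neg_antimono)

text \<open>All refutable formulas are equiprovable, so the choice of the variable is irrelevant.\<close>

lift_definition lind_zero :: "'v lindenbaum" is "Neg (Imp (Var undefined) (Var undefined))" .

lift_definition lind_scale :: "unit_real \<Rightarrow> 'v lindenbaum \<Rightarrow> 'v lindenbaum"
  is "\<lambda>r a. Neg (Nabla r (Neg a))"
  by (auto simp: equiprovable_def intro: Neg_antimono Nabla_mono)

text \<open>The index type \<open>'n\<close> of the coordinates serves as the set of the \<open>n = CARD('n)\<close> variables.\<close>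

definition RL :: "'n lindenbaum riesz_mv"
  where "RL =
    \<lparr>carrier = UNIV, mv_plus = lind_plus, mv_neg = lind_neg, mv_zero = lind_zero,
     mv_scale = lind_scale\<rparr>"

primrec term_fun :: "'n form \<Rightarrow> real ^ 'n \<Rightarrow> real"
  where
    "term_fun (Var i) x = x $ i"
  | "term_fun (Neg a) x = 1 - term_fun a x"
  | "term_fun (Imp a b) x = min 1 (1 - term_fun a x + term_fun b x)"
  | "term_fun (Nabla r a) x = 1 - of_unit r * (1 - term_fun a x)"

lemma term_fun_bounds:
  assumes "x \<in> cbox 0 1"
  shows "term_fun a x \<in> {0..1}"
proof (induction a)
  case (Var i)
  then show ?case using assms by (simp add: mem_box_cart)
next
  case (Nabla r a)
  have "of_unit r \<in> {0..1}" by (rule of_unit)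
  then have "of_unit r * (1 - term_fun a x) \<le> 1" "of_unit r * (1 - term_fun a x) \<ge> 0"
    using Nabla by (auto intro: mult_le_one)
  then show ?case by simp
qed auto

lemma provable_sound:
  assumes "\<turnstile> a" and x: "x \<in> cbox 0 1"
  shows "term_fun a x = 1"
  using assms(1)
proof induction
  case (L1 a b)
  show ?case using term_fun_bounds[OF x, of a] term_fun_bounds[OF x, of b] by simp
next
  case (L2 a b c)
  show ?case
    using term_fun_bounds[OF x, of a] term_fun_bounds[OF x, of b] term_fun_bounds[OF x, of c]
    by (simp add: min_def)
next
  case (L3 a b)
  show ?case using term_fun_bounds[OF x, of a] term_fun_bounds[OF x, of b] by (simp add: min_def)
next
  case (L4 a b)
  show ?case using term_fun_bounds[OF x, of a] term_fun_bounds[OF x, of b] by (simp add: min_def)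
next
  case (R1 r a b)
  have r: "of_unit r \<in> {0..1}" by (rule of_unit)
  show ?case
  proof (cases "term_fun a x \<le> term_fun b x")
    case True
    then have "of_unit r * term_fun a x \<le> of_unit r * term_fun b x"
      using r by (intro mult_left_mono) auto
    with True show ?thesis by (simp add: algebra_simps)
  next
    case False
    then have "of_unit r * term_fun b x \<le> of_unit r * term_fun a x"
      using r by (intro mult_left_mono) auto
    with False show ?thesis by (simp add: algebra_simps)
  qed
next
  case (R1' r a b)
  have r: "of_unit r \<in> {0..1}" by (rule of_unit)
  show ?case
  proof (cases "term_fun a x \<le> term_fun b x")
    case True
    then have "of_unit r * term_fun a x \<le> of_unit r * term_fun b x"
      using r by (intro mult_left_mono) auto
    with True show ?thesis by (simp add: algebra_simps)
  next
    case False
    then have "of_unit r * term_fun b x \<le> of_unit r * term_fun a x"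
      using r by (intro mult_left_mono) auto
    with False show ?thesis by (simp add: algebra_simps)
  qed
next
  case (R2 r q a)
  have d: "of_unit (unit_diff r q) = max 0 (of_unit r - of_unit q)" by transfer simp
  show ?case
  proof (cases "of_unit r \<le> of_unit q")
    case True
    then have "of_unit r * (1 - term_fun a x) \<le> of_unit q * (1 - term_fun a x)"
      using term_fun_bounds[OF x, of a] by (intro mult_right_mono) auto
    with True d show ?thesis by (simp add: max_def)
  next
    case False
    then have le: "of_unit q * (1 - term_fun a x) \<le> of_unit r * (1 - term_fun a x)"
      using term_fun_bounds[OF x, of a] by (intro mult_right_mono) auto
    have e: "of_unit (unit_diff r q) = of_unit r - of_unit q"
      using False d by simp
    from le show ?thesis unfolding term_fun.simps e by (simp add: algebra_simps)
  qed
next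
  case (R2' q a r)
  have d: "of_unit (unit_diff r q) = max 0 (of_unit r - of_unit q)" by transfer simp
  show ?case
  proof (cases "of_unit r \<le> of_unit q")
    case True
    with d show ?thesis by (simp add: max_def)
  next
    case False
    then have e: "of_unit (unit_diff r q) = of_unit r - of_unit q"
      using d by simp
    show ?thesis unfolding term_fun.simps e by (simp add: min_def algebra_simps)
  qed
next
  case (MP a b)
  then show ?case using term_fun_bounds[OF x, of b] by simp
qed (simp_all add: times_unit_real.rep_eq one_unit_real.rep_eq algebra_simps)

lemma equiprovable_term_fun:
  assumes "equiprovable a b" and "x \<in> cbox 0 1"
  shows "term_fun a x = term_fun b x"
proof -
  have "term_fun (Imp a b) x = 1" "term_fun (Imp b a) x = 1"
    using assms by (auto simp: equiprovable_def intro: provable_sound simp del: term_fun.simps)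
  then show ?thesis by (simp add: min_def split: if_splits)
qed

lift_definition RL_state :: "('n::finite) lindenbaum \<Rightarrow> real"
  is "\<lambda>a. \<integral>x. term_fun a x \<partial>cube_measure"
  by (rule Bochner_Integration.integral_cong)
    (auto simp: cube_measure_def intro: equiprovable_term_fun)

end

(* The state-induced distance on L1(mu)_u is the L1 distance, so state-completeness is Riesz-Fischer
   for [0,1]-valued functions. A state-preserving homomorphism with dense image into a state-complete
   algebra identifies that algebra with the norm-completion of the domain, by sending a class F to
   the set of sequences whose images converge to F; injectivity is not needed, because the completion
   identifies elements at distance 0. In particular no completeness theorem for the logic is used.
   For density of the term functions, the measurable sets whose indicator is an L1-limit of term
   functions are closed under complements and countable unions, and contain the half-spaces
   x_i > c because min 1 (n (x_i - c)^+) increases to their indicator; a [0,1]-valued function is a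
   uniform limit of means of indicators of its superlevel sets. *)

theory Submission
  imports Defs "HOL-Probability.Probability_Measure"
begin

section \<open>The algebra of integrable functions\<close>

text \<open>A folded name, so that the operations of \<open>L1_unit M\<close> can be computed on
  representatives by rewrite rules; the image under \<open>ae_rel M\<close> is unfolded only in the
  basic facts about classes.\<close>

definition ae_class :: "'x measure \<Rightarrow> ('x \<Rightarrow> real) \<Rightarrow> ('x \<Rightarrow> real) set"
  where "ae_class M f = ae_rel M `` {f}"

lemma of_unit_bounds: "0 \<le> of_unit r" "of_unit r \<le> 1"
  using of_unit[of r] by auto

lemma of_unit_unit_diff: "of_unit (unit_diff r q) = max 0 (of_unit r - of_unit q)"
  by transfer simp

section \<open>Functions with values in [0,1] on a finite measure space\<close>

context finite_measure
begin

text \<open>The constant bound 1 is integrable because the measure is finite. Integrability thus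
  reduces to measurability, and closure under the operations becomes a matter of measurability and
  bounds.\<close>

lemma unit_integrable_iff:
  "f \<in> unit_integrable M \<longleftrightarrow> f \<in> borel_measurable M \<and> (\<forall>x\<in>space M. 0 \<le> f x \<and> f x \<le> 1)"
proof -
  have "integrable M f"
    if "f \<in> borel_measurable M" and b: "\<And>x. x \<in> space M \<Longrightarrow> 0 \<le> f x \<and> f x \<le> 1"
  proof (rule integrable_const_bound)
    show "AE x in M. norm (f x) \<le> 1"
      by (rule AE_I2) (simp add: b)
  qed fact
  then show ?thesis
    unfolding unit_integrable_def Pi_iff mem_Collect_eq atLeastAtMost_iff
    using borel_measurable_integrable by metis
qed

lemma unit_integrable_integrable: "f \<in> unit_integrable M \<Longrightarrow> integrable M f"
  by (simp add: unit_integrable_def)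

lemma unit_integrable_measurable: "f \<in> unit_integrable M \<Longrightarrow> f \<in> borel_measurable M"
  by (simp add: unit_integrable_iff)

lemma unit_integrable_bounds:
  assumes "f \<in> unit_integrable M" "x \<in> space M"
  shows "0 \<le> f x" "f x \<le> 1"
  using assms by (auto simp: unit_integrable_iff)

lemma unit_integrable_const: "0 \<le> c \<Longrightarrow> c \<le> 1 \<Longrightarrow> (\<lambda>x. c) \<in> unit_integrable M"
  by (simp add: unit_integrable_iff)

lemma unit_integrable_plus:
  assumes "f \<in> unit_integrable M" "g \<in> unit_integrable M"
  shows "(\<lambda>x. min 1 (f x + g x)) \<in> unit_integrable M"
  using assms by (auto simp: unit_integrable_iff)

lemma unit_integrable_neg: "f \<in> unit_integrable M \<Longrightarrow> (\<lambda>x. 1 - f x) \<in> unit_integrable M"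
  by (auto simp: unit_integrable_iff)

lemma unit_integrable_scale:
  "f \<in> unit_integrable M \<Longrightarrow> (\<lambda>x. of_unit r * f x) \<in> unit_integrable M"
  by (auto simp: unit_integrable_iff of_unit_bounds intro: mult_le_one)

lemma unit_integrable_mult:
  assumes "f \<in> unit_integrable M" "g \<in> unit_integrable M"
  shows "(\<lambda>x. max 0 (f x + g x - 1)) \<in> unit_integrable M"
  unfolding unit_integrable_iff
proof (intro conjI ballI)
  show "(\<lambda>x. max 0 (f x + g x - 1)) \<in> borel_measurable M"
    using assms[THEN unit_integrable_measurable] by measurable
  fix x assume x: "x \<in> space M"
  show "0 \<le> max 0 (f x + g x - 1)" "max 0 (f x + g x - 1) \<le> 1"
    using unit_integrable_bounds[OF assms(1) x] unit_integrable_bounds[OF assms(2) x] by simp_all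
qed

lemmas unit_integrable_closed =
  unit_integrable_plus unit_integrable_neg unit_integrable_scale unit_integrable_mult
  unit_integrable_const[OF order_refl zero_le_one] unit_integrable_const[OF zero_le_one order_refl]

section \<open>Equality almost everywhere and the operations on classes\<close>

lemma equiv_ae_rel: "equiv (unit_integrable M) (ae_rel M)"
proof (rule equivI)
  show "trans (ae_rel M)"
  proof (rule transI)
    fix f g h assume "(f, g) \<in> ae_rel M" "(g, h) \<in> ae_rel M"
    then have "AE x in M. f x = g x" "AE x in M. g x = h x"
      and fh: "f \<in> unit_integrable M" "h \<in> unit_integrable M"
      by (simp_all add: ae_rel_def)
    from this(1,2) have "AE x in M. f x = h x" by eventually_elim simp
    with fh show "(f, h) \<in> ae_rel M" by (simp add: ae_rel_def)
  qed
qed (auto simp: ae_rel_def refl_on_def sym_def eq_commute)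

lemma ae_class_eq_iff:
  assumes "f \<in> unit_integrable M" "g \<in> unit_integrable M"
  shows "ae_class M f = ae_class M g \<longleftrightarrow> (AE x in M. f x = g x)"
  unfolding ae_class_def eq_equiv_class_iff[OF equiv_ae_rel assms] using assms
  by (simp add: ae_rel_def)

text \<open>Measurability and bounds depend only on the values on \<open>space M\<close>, so
  \<open>g\<close> inherits membership from \<open>f\<close>. Identities that hold only for numbers
  in [0,1] can therefore be lifted to classes.\<close>

lemma ae_class_cong:
  assumes "f \<in> unit_integrable M" "\<And>x. x \<in> space M \<Longrightarrow> f x = g x"
  shows "ae_class M f = ae_class M g"
proof -
  have "g \<in> unit_integrable M"
    using assms measurable_cong[of M f g borel] by (simp add: unit_integrable_iff)
  then show ?thesis using assms by (simp add: ae_class_eq_iff)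
qed

lemma carrier_L1_unit: "carrier (L1_unit M) = ae_class M ` unit_integrable M"
  by (auto simp: L1_unit_def quotient_def ae_class_def)

lemma ae_class_in_carrier: "f \<in> unit_integrable M \<Longrightarrow> ae_class M f \<in> carrier (L1_unit M)"
  by (simp add: carrier_L1_unit)

text \<open>The truncated sum respects equality almost everywhere, so all classes in the defining
  union over representatives coincide and the union collapses. Negation and scaling follow the same
  pattern.\<close>

lemma L1_unit_plus:
  assumes "f \<in> unit_integrable M" "g \<in> unit_integrable M"
  shows "ae_class M f \<oplus>\<^bsub>L1_unit M\<^esub> ae_class M g = ae_class M (\<lambda>x. min 1 (f x + g x))"
proof -
  have "congruent2 (ae_rel M) (ae_rel M) (\<lambda>f g. ae_rel M `` {\<lambda>x. min 1 (f x + g x)})"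
  proof (rule congruent2I')
    fix f f' g g' assume "(f, f') \<in> ae_rel M" "(g, g') \<in> ae_rel M"
    then have "AE x in M. f x = f' x" "AE x in M. g x = g' x"
      and U: "f \<in> unit_integrable M" "f' \<in> unit_integrable M"
        "g \<in> unit_integrable M" "g' \<in> unit_integrable M"
      by (simp_all add: ae_rel_def)
    from this(1,2) have "AE x in M. min 1 (f x + g x) = min 1 (f' x + g' x)"
      by eventually_elim simp
    with U have "(\<lambda>x. min 1 (f x + g x), \<lambda>x. min 1 (f' x + g' x)) \<in> ae_rel M"
      by (simp add: ae_rel_def unit_integrable_plus)
    then show "ae_rel M `` {\<lambda>x. min 1 (f x + g x)} = ae_rel M `` {\<lambda>x. min 1 (f' x + g' x)}"
      by (rule equiv_class_eq[OF equiv_ae_rel])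
  qed
  from UN_equiv_class2[OF equiv_ae_rel equiv_ae_rel this assms] show ?thesis
    by (simp add: L1_unit_def ae_class_def)
qed

lemma L1_unit_neg:
  assumes "f \<in> unit_integrable M"
  shows "\<ominus>\<^bsub>L1_unit M\<^esub> ae_class M f = ae_class M (\<lambda>x. 1 - f x)"
proof -
  have "congruent (ae_rel M) (\<lambda>f. ae_rel M `` {\<lambda>x. 1 - f x})"
  proof (rule congruentI)
    fix f f' assume "(f, f') \<in> ae_rel M"
    then have "(\<lambda>x. 1 - f x, \<lambda>x. 1 - f' x) \<in> ae_rel M"
      by (auto simp: ae_rel_def unit_integrable_closed)
    then show "ae_rel M `` {\<lambda>x. 1 - f x} = ae_rel M `` {\<lambda>x. 1 - f' x}"
      by (rule equiv_class_eq[OF equiv_ae_rel])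
  qed
  from UN_equiv_class[OF equiv_ae_rel this assms] show ?thesis
    by (simp add: L1_unit_def ae_class_def)
qed

lemma L1_unit_scale:
  assumes "f \<in> unit_integrable M"
  shows "mv_scale (L1_unit M) r (ae_class M f) = ae_class M (\<lambda>x. of_unit r * f x)"
proof -
  have "congruent (ae_rel M) (\<lambda>f. ae_rel M `` {\<lambda>x. of_unit r * f x})"
  proof (rule congruentI)
    fix f f' assume "(f, f') \<in> ae_rel M"
    then have "(\<lambda>x. of_unit r * f x, \<lambda>x. of_unit r * f' x) \<in> ae_rel M"
      by (auto simp: ae_rel_def unit_integrable_closed)
    then show "ae_rel M `` {\<lambda>x. of_unit r * f x} = ae_rel M `` {\<lambda>x. of_unit r * f' x}"
      by (rule equiv_class_eq[OF equiv_ae_rel])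
  qed
  from UN_equiv_class[OF equiv_ae_rel this assms] show ?thesis
    by (simp add: L1_unit_def ae_class_def)
qed

lemma L1_unit_zero: "\<zero>\<^bsub>L1_unit M\<^esub> = ae_class M (\<lambda>x. 0)"
  by (simp add: L1_unit_def ae_class_def)

lemma L1_unit_one: "\<one>\<^bsub>L1_unit M\<^esub> = ae_class M (\<lambda>x. 1)"
  by (simp add: mv_one_def L1_unit_zero L1_unit_neg unit_integrable_closed)

lemma L1_unit_mult:
  assumes "f \<in> unit_integrable M" "g \<in> unit_integrable M"
  shows "ae_class M f \<odot>\<^bsub>L1_unit M\<^esub> ae_class M g = ae_class M (\<lambda>x. max 0 (f x + g x - 1))"
proof -
  have "ae_class M f \<odot>\<^bsub>L1_unit M\<^esub> ae_class M g
      = ae_class M (\<lambda>x. 1 - min 1 ((1 - f x) + (1 - g x)))"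
    using assms by (simp only: mv_mult_def L1_unit_plus L1_unit_neg unit_integrable_closed)
  also have "(\<lambda>x. 1 - min 1 ((1 - f x) + (1 - g x))) = (\<lambda>x. max 0 (f x + g x - 1))"
    by (auto simp: fun_eq_iff)
  finally show ?thesis .
qed

lemmas L1_unit_simps = L1_unit_plus L1_unit_neg L1_unit_scale L1_unit_zero L1_unit_one L1_unit_mult

text \<open>All members of a class have the same integral. The definite description is unique
  because the class is nonempty: it contains \<open>f\<close>.\<close>

lemma L1_state_ae_class:
  assumes "f \<in> unit_integrable M"
  shows "L1_state M (ae_class M f) = (\<integral>x. f x \<partial>M)"
proof -
  have "(\<integral>x. f x \<partial>M) = (\<integral>x. g x \<partial>M)" if "g \<in> ae_class M f" for g
  proof (rule integral_cong_AE)
    show "AE x in M. f x = g x" "f \<in> borel_measurable M" "g \<in> borel_measurable M"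
      using that by (simp_all add: ae_class_def ae_rel_def unit_integrable_measurable)
  qed
  moreover have "f \<in> ae_class M f"
    unfolding ae_class_def using equiv_ae_rel assms by (rule equiv_class_self)
  ultimately show ?thesis
    unfolding L1_state_def by (intro the_equality ballI) (assumption, drule (1) bspec)
qed

text \<open>On representatives every axiom is a pointwise identity of real numbers. Those valid only
  for values in [0,1] pass through \<open>ae_class_cong\<close>; the others are equalities of
  functions. The elements are introduced one at a time, each axiom being proved as soon as its
  variables are available.\<close>

lemma riesz_mv_algebra_L1_unit: "riesz_mv_algebra (L1_unit M)"
proof
  fix X Y Z r q
  note calc = L1_unit_simps unit_integrable_closed times_unit_real.rep_eq one_unit_real.rep_eq
  assume "X \<in> carrier (L1_unit M)"
  then obtain f where f: "f \<in> unit_integrable M" and X: "X = ae_class M f"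
    by (auto simp: carrier_L1_unit)
  note bf = unit_integrable_bounds[OF f]
  show "\<ominus>\<^bsub>L1_unit M\<^esub> X \<in> carrier (L1_unit M)"
    "mv_scale (L1_unit M) r X \<in> carrier (L1_unit M)"
    by (simp_all only: X f calc ae_class_in_carrier)
  have "ae_class M (\<lambda>x. min 1 (f x + 0)) = ae_class M f"
    by (rule ae_class_cong) (simp_all only: f calc, simp add: bf)
  then show "X \<oplus>\<^bsub>L1_unit M\<^esub> \<zero>\<^bsub>L1_unit M\<^esub> = X"
    by (simp only: X f calc)
  show "\<ominus>\<^bsub>L1_unit M\<^esub> (\<ominus>\<^bsub>L1_unit M\<^esub> X) = X"
    by (simp only: X f calc) simp
  have "ae_class M (\<lambda>x. min 1 (1 - 0 + f x)) = ae_class M (\<lambda>x. 1 - 0)"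
    by (rule ae_class_cong) (simp_all only: f calc, simp add: bf)
  then show "\<ominus>\<^bsub>L1_unit M\<^esub> \<zero>\<^bsub>L1_unit M\<^esub> \<oplus>\<^bsub>L1_unit M\<^esub> X = \<ominus>\<^bsub>L1_unit M\<^esub> \<zero>\<^bsub>L1_unit M\<^esub>"
    by (simp only: X f calc)
  show "mv_scale (L1_unit M) 1 X = X"
    by (simp only: X f calc mult_1)
  show "mv_scale (L1_unit M) r (mv_scale (L1_unit M) q X) = mv_scale (L1_unit M) (r * q) X"
    by (simp only: X f calc mult.assoc)
  show "mv_scale (L1_unit M) (unit_diff r q) X =
    mv_scale (L1_unit M) r X \<odot>\<^bsub>L1_unit M\<^esub> (\<ominus>\<^bsub>L1_unit M\<^esub> (mv_scale (L1_unit M) q X))"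
  proof -
    \<comment> \<open>Multiplication by \<open>f x\<close> commutes with truncation at 0 because
      \<open>f x\<close> is nonnegative, hence the restriction to \<open>space M\<close>. For
      \<open>scale_mult_neg\<close> below, the nonnegative factor is the scalar, so the identity
      holds at every point.\<close>
    have "of_unit (unit_diff r q) * f x = max 0 (of_unit r * f x + (1 - of_unit q * f x) - 1)"
      if "x \<in> space M" for x
      using max_mult_distrib_right[of 0 "of_unit r - of_unit q" "f x"] bf(1)[OF that]
      by (simp add: of_unit_unit_diff left_diff_distrib)
    then show ?thesis
      unfolding X by (simp only: f calc) (rule ae_class_cong; simp only: f calc)
  qed
  assume "Y \<in> carrier (L1_unit M)"
  then obtain g where g: "g \<in> unit_integrable M" and Y: "Y = ae_class M g"
    by (auto simp: carrier_L1_unit)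
  note bg = unit_integrable_bounds[OF g]
  show "X \<oplus>\<^bsub>L1_unit M\<^esub> Y \<in> carrier (L1_unit M)"
    by (simp only: X Y f g calc ae_class_in_carrier)
  show "X \<oplus>\<^bsub>L1_unit M\<^esub> Y = Y \<oplus>\<^bsub>L1_unit M\<^esub> X"
    by (simp only: X Y f g calc add.commute)
  show "\<ominus>\<^bsub>L1_unit M\<^esub> (\<ominus>\<^bsub>L1_unit M\<^esub> X \<oplus>\<^bsub>L1_unit M\<^esub> Y) \<oplus>\<^bsub>L1_unit M\<^esub> Y
      = \<ominus>\<^bsub>L1_unit M\<^esub> (\<ominus>\<^bsub>L1_unit M\<^esub> Y \<oplus>\<^bsub>L1_unit M\<^esub> X) \<oplus>\<^bsub>L1_unit M\<^esub> X"
  proof -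
    \<comment> \<open>Both sides are the maximum of \<open>f x\<close> and
      \<open>g x\<close>.\<close>
    have "min 1 (1 - min 1 (1 - f x + g x) + g x) = min 1 (1 - min 1 (1 - g x + f x) + f x)"
      if "x \<in> space M" for x
      using bf[OF that] bg[OF that] by (simp add: min_def)
    then show ?thesis
      unfolding X Y by (simp only: f g calc) (rule ae_class_cong; simp only: f g calc)
  qed
  show "mv_scale (L1_unit M) r (X \<odot>\<^bsub>L1_unit M\<^esub> (\<ominus>\<^bsub>L1_unit M\<^esub> Y)) =
    mv_scale (L1_unit M) r X \<odot>\<^bsub>L1_unit M\<^esub> (\<ominus>\<^bsub>L1_unit M\<^esub> (mv_scale (L1_unit M) r Y))"
  proof -
    have "of_unit r * max 0 (f x + (1 - g x) - 1)
        = max 0 (of_unit r * f x + (1 - of_unit r * g x) - 1)" for x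
      using max_mult_distrib_left[of "of_unit r" 0 "f x - g x"]
      by (simp add: of_unit_bounds right_diff_distrib)
    then show ?thesis
      unfolding X Y by (simp only: f g calc)
  qed
  assume "Z \<in> carrier (L1_unit M)"
  then obtain h where h: "h \<in> unit_integrable M" and Z: "Z = ae_class M h"
    by (auto simp: carrier_L1_unit)
  show "X \<oplus>\<^bsub>L1_unit M\<^esub> Y \<oplus>\<^bsub>L1_unit M\<^esub> Z = X \<oplus>\<^bsub>L1_unit M\<^esub> (Y \<oplus>\<^bsub>L1_unit M\<^esub> Z)"
  proof -
    \<comment> \<open>Both sides are \<open>min 1 (f x + g x + h x)\<close>: the inner truncation is
      absorbed because the remaining summand is nonnegative.\<close>
    have "min 1 (min 1 (f x + g x) + h x) = min 1 (f x + min 1 (g x + h x))"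
      if "x \<in> space M" for x
      using bf[OF that] bg[OF that] unit_integrable_bounds[OF h that] by (simp add: min_def)
    then show ?thesis
      unfolding X Y Z by (simp only: f g h calc) (rule ae_class_cong; simp only: f g h calc)
  qed
next
  show "\<zero>\<^bsub>L1_unit M\<^esub> \<in> carrier (L1_unit M)"
    by (simp only: L1_unit_zero ae_class_in_carrier unit_integrable_closed)
qed

text \<open>At each point at most one of the two truncated differences is nonzero, and it is at most
  1, so their truncated sum is the absolute difference.\<close>

lemma L1_dist_ae_class:
  assumes f: "f \<in> unit_integrable M" and g: "g \<in> unit_integrable M"
  shows "state_dist (L1_unit M) (L1_state M) (ae_class M f) (ae_class M g)
    = (\<integral>x. \<bar>f x - g x\<bar> \<partial>M)"
proof -
  have *: "min 1 (max 0 (f x + (1 - g x) - 1) + max 0 (1 - f x + g x - 1)) = \<bar>f x - g x\<bar>"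
    if "x \<in> space M" for x
    using unit_integrable_bounds[OF f that] unit_integrable_bounds[OF g that]
    by (simp add: min_def max_def abs_if)
  have "state_dist (L1_unit M) (L1_state M) (ae_class M f) (ae_class M g)
    = (\<integral>x. min 1 (max 0 (f x + (1 - g x) - 1) + max 0 (1 - f x + g x - 1)) \<partial>M)"
    by (simp only: state_dist_def L1_unit_simps unit_integrable_closed ae_class_in_carrier
        L1_state_ae_class f g simp_thms if_True)
  also have "\<dots> = (\<integral>x. \<bar>f x - g x\<bar> \<partial>M)"
    by (rule Bochner_Integration.integral_cong[OF refl *])
  finally show ?thesis .
qed

end

text \<open>The hypothesis that the product is zero says that \<open>f + g\<close> is at most 1
  almost everywhere, so the truncation in the sum is inactive there and additivity is that of the
  integral. Total mass 1 normalizes the state.\<close>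

lemma (in prob_space) mv_state_L1_unit: "mv_state (L1_unit M) (L1_state M)"
  unfolding mv_state_def
proof (intro conjI ballI impI)
  have "0 \<le> (\<integral>x. f x \<partial>M)" "(\<integral>x. f x \<partial>M) \<le> 1" if f: "f \<in> unit_integrable M" for f
  proof -
    show "0 \<le> (\<integral>x. f x \<partial>M)"
      by (rule Bochner_Integration.integral_nonneg) (rule unit_integrable_bounds[OF f])
    show "(\<integral>x. f x \<partial>M) \<le> 1"
      by (rule integral_le_const[OF unit_integrable_integrable[OF f] AE_I2])
        (rule unit_integrable_bounds[OF f])
  qed
  then show "L1_state M \<in> carrier (L1_unit M) \<rightarrow> {0..1}"
    by (auto simp: carrier_L1_unit L1_state_ae_class)
  show "L1_state M \<one>\<^bsub>L1_unit M\<^esub> = 1"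
    by (simp add: L1_unit_one L1_state_ae_class unit_integrable_closed prob_space)
  fix X Y assume "X \<in> carrier (L1_unit M)" "Y \<in> carrier (L1_unit M)"
    and XY: "X \<odot>\<^bsub>L1_unit M\<^esub> Y = \<zero>\<^bsub>L1_unit M\<^esub>"
  then obtain f g where f: "f \<in> unit_integrable M" and X: "X = ae_class M f"
    and g: "g \<in> unit_integrable M" and Y: "Y = ae_class M g"
    by (auto simp: carrier_L1_unit)
  have "ae_class M (\<lambda>x. max 0 (f x + g x - 1)) = ae_class M (\<lambda>x. 0)"
    using XY by (simp only: X Y L1_unit_simps f g)
  then have "AE x in M. max 0 (f x + g x - 1) = 0"
    by (simp only: ae_class_eq_iff unit_integrable_closed f g)
  then have "AE x in M. min 1 (f x + g x) = f x + g x"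
    by eventually_elim simp
  then have "(\<integral>x. min 1 (f x + g x) \<partial>M) = (\<integral>x. f x + g x \<partial>M)"
    using f[THEN unit_integrable_measurable] g[THEN unit_integrable_measurable]
    by (intro integral_cong_AE borel_measurable_min borel_measurable_add borel_measurable_const)
  also have "\<dots> = (\<integral>x. f x \<partial>M) + (\<integral>x. g x \<partial>M)"
    using f g by (simp add: unit_integrable_integrable)
  finally show "L1_state M (X \<oplus>\<^bsub>L1_unit M\<^esub> Y) = L1_state M X + L1_state M Y"
    by (simp only: X Y L1_unit_simps L1_state_ae_class unit_integrable_closed f g)
qed

section \<open>The distance induced by the state\<close>

abbreviation L1_dist :: "'x measure \<Rightarrow> ('x \<Rightarrow> real) set \<Rightarrow> ('x \<Rightarrow> real) set \<Rightarrow> real"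
  where "L1_dist M \<equiv> state_dist (L1_unit M) (L1_state M)"

context finite_measure
begin

section \<open>The L1 distance as a complete metric\<close>

lemma integrable_abs_diff:
  assumes "f \<in> unit_integrable M" "g \<in> unit_integrable M"
  shows "integrable M (\<lambda>x. \<bar>f x - g x\<bar>)"
  using assms[THEN unit_integrable_integrable] by (intro integrable_abs Bochner_Integration.integrable_diff)

lemma integral_abs_diff_triangle:
  assumes "f \<in> unit_integrable M" "g \<in> unit_integrable M" "h \<in> unit_integrable M"
  shows "(\<integral>x. \<bar>f x - h x\<bar> \<partial>M) \<le> (\<integral>x. \<bar>f x - g x\<bar> \<partial>M) + (\<integral>x. \<bar>g x - h x\<bar> \<partial>M)"
proof -
  have "(\<integral>x. \<bar>f x - h x\<bar> \<partial>M) \<le> (\<integral>x. \<bar>f x - g x\<bar> + \<bar>g x - h x\<bar> \<partial>M)"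
    using assms by (intro integral_mono integrable_abs_diff Bochner_Integration.integrable_add) auto
  then show ?thesis using assms by (simp add: integrable_abs_diff)
qed

text \<open>Dominated convergence: the differences are bounded by the constant 1, which is
  integrable on a finite measure space.\<close>

lemma integral_abs_diff_tendsto_0:
  assumes f: "\<And>i. f i \<in> unit_integrable M" and g: "g \<in> unit_integrable M"
    and lim: "AE x in M. (\<lambda>i. f i x) \<longlonglongrightarrow> g x"
  shows "(\<lambda>i. \<integral>x. \<bar>f i x - g x\<bar> \<partial>M) \<longlonglongrightarrow> 0"
proof -
  from lim have "AE x in M. (\<lambda>i. \<bar>f i x - g x\<bar>) \<longlonglongrightarrow> 0"
  proof eventually_elim
    fix x assume "(\<lambda>i. f i x) \<longlonglongrightarrow> g x"
    from tendsto_rabs[OF LIM_zero[OF this]] show "(\<lambda>i. \<bar>f i x - g x\<bar>) \<longlonglongrightarrow> 0" by simp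
  qed
  then have "(\<lambda>i. \<integral>x. \<bar>f i x - g x\<bar> \<partial>M) \<longlonglongrightarrow> (\<integral>x. 0 \<partial>M)"
  proof (rule integral_dominated_convergence[where w="\<lambda>_. 1", rotated -2])
    show "AE x in M. norm \<bar>f i x - g x\<bar> \<le> 1" for i
    proof (rule AE_I2)
      fix x assume x: "x \<in> space M"
      show "norm \<bar>f i x - g x\<bar> \<le> 1"
        using unit_integrable_bounds[OF f x, of i] unit_integrable_bounds[OF g x] by simp
    qed
  qed (use integrable_abs_diff[OF f g] in \<open>simp_all add: borel_measurable_integrable\<close>)
  then show ?thesis by simp
qed

lemma L1_unit_cases:
  assumes "F \<in> carrier (L1_unit M)"
  obtains f where "f \<in> unit_integrable M" "F = ae_class M f"
  using assms by (auto simp: carrier_L1_unit)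

text \<open>Points are separated because a nonnegative function with integral 0 vanishes almost
  everywhere. Nonnegativity and symmetry range over the whole type, so arguments off the carrier,
  where \<open>state_dist\<close> is 0, are split off.\<close>

lemma Metric_space_L1_dist: "Metric_space (carrier (L1_unit M)) (L1_dist M)"
proof
  fix F G
  show "0 \<le> L1_dist M F G"
  proof (cases "F \<in> carrier (L1_unit M) \<and> G \<in> carrier (L1_unit M)")
    case True
    then obtain f g where "f \<in> unit_integrable M" "F = ae_class M f"
      "g \<in> unit_integrable M" "G = ae_class M g"
      by (auto elim!: L1_unit_cases)
    then show ?thesis by (simp add: L1_dist_ae_class)
  qed (auto simp: state_dist_def)
  show "L1_dist M F G = L1_dist M G F"
  proof (cases "F \<in> carrier (L1_unit M) \<and> G \<in> carrier (L1_unit M)")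
    case True
    then obtain f g where "f \<in> unit_integrable M" "F = ae_class M f"
      "g \<in> unit_integrable M" "G = ae_class M g"
      by (auto elim!: L1_unit_cases)
    then show ?thesis by (simp add: L1_dist_ae_class abs_minus_commute)
  qed (auto simp: state_dist_def)
next
  fix F G assume "F \<in> carrier (L1_unit M)" "G \<in> carrier (L1_unit M)"
  then obtain f g where f: "f \<in> unit_integrable M" "F = ae_class M f"
    and g: "g \<in> unit_integrable M" "G = ae_class M g"
    by (auto elim!: L1_unit_cases)
  have "(\<integral>x. \<bar>f x - g x\<bar> \<partial>M) = 0 \<longleftrightarrow> (AE x in M. \<bar>f x - g x\<bar> = 0)"
    by (rule integral_nonneg_eq_0_iff_AE[OF integrable_abs_diff[OF f(1) g(1)]]) simp
  also have "\<dots> \<longleftrightarrow> (AE x in M. f x = g x)" by simp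
  finally show "L1_dist M F G = 0 \<longleftrightarrow> F = G"
    using f g by (simp add: L1_dist_ae_class ae_class_eq_iff)
next
  fix F G H assume "F \<in> carrier (L1_unit M)" "G \<in> carrier (L1_unit M)" "H \<in> carrier (L1_unit M)"
  then obtain f g h where f: "f \<in> unit_integrable M" "F = ae_class M f"
    and g: "g \<in> unit_integrable M" "G = ae_class M g"
    and h: "h \<in> unit_integrable M" "H = ae_class M h"
    by (auto elim!: L1_unit_cases)
  then show "L1_dist M F H \<le> L1_dist M F G + L1_dist M G H"
    using integral_abs_diff_triangle[of f g h] by (simp add: L1_dist_ae_class)
qed

sublocale L1: Metric_space "carrier (L1_unit M)" "L1_dist M"
  by (rule Metric_space_L1_dist)

text \<open>An L1-Cauchy sequence has a subsequence converging almost everywhere; dominated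
  convergence makes it converge in L1, and a Cauchy sequence with a convergent subsequence
  converges.\<close>

lemma mcomplete_L1_dist: "L1.mcomplete"
  unfolding L1.mcomplete_def
proof (intro allI impI)
  fix F assume F: "L1.MCauchy F"
  then have "F n \<in> carrier (L1_unit M)" for n
    by (auto simp: L1.MCauchy_def)
  then have "\<exists>f. f \<in> unit_integrable M \<and> F n = ae_class M f" for n
    by (meson L1_unit_cases)
  then obtain f where f: "\<And>n. f n \<in> unit_integrable M" and Ff: "\<And>n. F n = ae_class M (f n)"
    by metis
  have "\<exists>N. \<forall>i\<ge>N. \<forall>j\<ge>N. (\<integral>x. norm (f i x - f j x) \<partial>M) < e" if "e > 0" for e :: real
    using F that by (auto simp: L1.MCauchy_def Ff L1_dist_ae_class f)
  then obtain r where r: "strict_mono r" and cau: "AE x in M. Cauchy (\<lambda>i. f (r i) x)"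
    using cauchy_L1_AE_cauchy_subseq[of M f] unit_integrable_integrable[OF f] by blast
  \<comment> \<open>Where the subsequence diverges, \<open>lim\<close> is arbitrary. Clamping forces
    all values into [0,1] and leaves every genuine limit on \<open>space M\<close>
    unchanged.\<close>
  define g where "g x = max 0 (min 1 (lim (\<lambda>i. f (r i) x)))" for x
  have g: "g \<in> unit_integrable M"
    unfolding unit_integrable_iff g_def using f[THEN unit_integrable_measurable]
    by (auto intro!: borel_measurable_max borel_measurable_min borel_measurable_lim_metric)
  have "AE x in M. (\<lambda>i. f (r i) x) \<longlonglongrightarrow> g x"
    using cau AE_space
  proof eventually_elim
    fix x assume "Cauchy (\<lambda>i. f (r i) x)" and x: "x \<in> space M"
    then have lim: "(\<lambda>i. f (r i) x) \<longlonglongrightarrow> lim (\<lambda>i. f (r i) x)"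
      by (simp add: Cauchy_convergent_iff convergent_LIMSEQ_iff)
    then have "0 \<le> lim (\<lambda>i. f (r i) x)"
      by (rule LIMSEQ_le_const) (use unit_integrable_bounds(1)[OF f x] in blast)
    moreover have "lim (\<lambda>i. f (r i) x) \<le> 1"
      using lim by (rule LIMSEQ_le_const2) (use unit_integrable_bounds(2)[OF f x] in blast)
    ultimately have "g x = lim (\<lambda>i. f (r i) x)"
      by (simp add: g_def)
    with lim show "(\<lambda>i. f (r i) x) \<longlonglongrightarrow> g x" by simp
  qed
  from integral_abs_diff_tendsto_0[OF f g this]
  have "(\<lambda>i. L1_dist M (F (r i)) (ae_class M g)) \<longlonglongrightarrow> 0"
    by (simp add: Ff L1_dist_ae_class f g)
  then have "limitin L1.mtopology (F \<circ> r) (ae_class M g) sequentially"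
    by (simp add: L1.limit_metric_sequentially Ff ae_class_in_carrier f g LIMSEQ_iff)
  with L1.MCauchy_convergent_subsequence[OF F r]
  show "\<exists>G. limitin L1.mtopology F G sequentially" by blast
qed

lemma state_complete_L1_unit: "state_complete (L1_unit M) (L1_state M)"
  unfolding state_complete_def using Metric_space_L1_dist mcomplete_L1_dist by blast

text \<open>Truncation at 1 does not increase distances, so the bound holds pointwise before
  integration. With the next three lemmas this makes the operations and the state continuous, which
  transports limits to the completion.\<close>

lemma L1_dist_plus_le:
  assumes "F \<in> carrier (L1_unit M)" "F' \<in> carrier (L1_unit M)"
    and "G \<in> carrier (L1_unit M)" "G' \<in> carrier (L1_unit M)"
  shows "L1_dist M (F \<oplus>\<^bsub>L1_unit M\<^esub> G) (F' \<oplus>\<^bsub>L1_unit M\<^esub> G') \<le> L1_dist M F F' + L1_dist M G G'"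
proof -
  obtain f f' g g' where f: "f \<in> unit_integrable M" "F = ae_class M f"
    and f': "f' \<in> unit_integrable M" "F' = ae_class M f'"
    and g: "g \<in> unit_integrable M" "G = ae_class M g"
    and g': "g' \<in> unit_integrable M" "G' = ae_class M g'"
    using assms by (auto elim!: L1_unit_cases)
  have "(\<integral>x. \<bar>min 1 (f x + g x) - min 1 (f' x + g' x)\<bar> \<partial>M)
    \<le> (\<integral>x. \<bar>f x - f' x\<bar> + \<bar>g x - g' x\<bar> \<partial>M)"
    using f f' g g'
    by (intro integral_mono integrable_abs_diff Bochner_Integration.integrable_add
        unit_integrable_plus) auto
  then show ?thesis
    using f f' g g'
    by (simp add: L1_dist_ae_class L1_unit_plus unit_integrable_plus integrable_abs_diff)
qed

lemma L1_dist_neg: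
  assumes "F \<in> carrier (L1_unit M)" "F' \<in> carrier (L1_unit M)"
  shows "L1_dist M (\<ominus>\<^bsub>L1_unit M\<^esub> F) (\<ominus>\<^bsub>L1_unit M\<^esub> F') = L1_dist M F F'"
proof -
  obtain f f' where "f \<in> unit_integrable M" "F = ae_class M f"
    and "f' \<in> unit_integrable M" "F' = ae_class M f'"
    using assms by (auto elim!: L1_unit_cases)
  then show ?thesis
    by (simp add: L1_dist_ae_class L1_unit_neg unit_integrable_neg abs_minus_commute)
qed

lemma L1_dist_scale:
  assumes "F \<in> carrier (L1_unit M)" "F' \<in> carrier (L1_unit M)"
  shows "L1_dist M (mv_scale (L1_unit M) r F) (mv_scale (L1_unit M) r F') = of_unit r * L1_dist M F F'"
proof -
  obtain f f' where "f \<in> unit_integrable M" "F = ae_class M f"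
    and "f' \<in> unit_integrable M" "F' = ae_class M f'"
    using assms by (auto elim!: L1_unit_cases)
  then show ?thesis
    by (simp add: L1_dist_ae_class L1_unit_scale unit_integrable_scale abs_mult of_unit_bounds
        flip: right_diff_distrib)
qed

lemma L1_state_diff_le:
  assumes "F \<in> carrier (L1_unit M)" "G \<in> carrier (L1_unit M)"
  shows "\<bar>L1_state M F - L1_state M G\<bar> \<le> L1_dist M F G"
proof -
  obtain f g where "f \<in> unit_integrable M" "F = ae_class M f"
    and "g \<in> unit_integrable M" "G = ae_class M g"
    using assms by (auto elim!: L1_unit_cases)
  then show ?thesis
    using integral_abs_bound[of M "\<lambda>x. f x - g x"]
    by (simp add: L1_dist_ae_class L1_state_ae_class unit_integrable_integrable)
qed

end

section \<open>Norm-completion from a dense homomorphism\<close>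

text \<open>Isolates the completion argument from the logic: \<open>\<psi>\<close> will later send
  the class of a formula to the class of its term function.\<close>

locale dense_L1_hom = finite_measure M for M :: "'x measure" +
  fixes R :: "('a, 'm) riesz_mv_scheme" and s :: "'a \<Rightarrow> real" and \<psi> :: "'a \<Rightarrow> ('x \<Rightarrow> real) set"
  assumes R_plus: "a \<in> carrier R \<Longrightarrow> b \<in> carrier R \<Longrightarrow> a \<oplus>\<^bsub>R\<^esub> b \<in> carrier R"
    and R_neg: "a \<in> carrier R \<Longrightarrow> \<ominus>\<^bsub>R\<^esub> a \<in> carrier R"
    and R_zero: "\<zero>\<^bsub>R\<^esub> \<in> carrier R"
    and R_scale: "a \<in> carrier R \<Longrightarrow> mv_scale R r a \<in> carrier R"
    and hom_closed: "a \<in> carrier R \<Longrightarrow> \<psi> a \<in> carrier (L1_unit M)"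
    and hom_plus: "a \<in> carrier R \<Longrightarrow> b \<in> carrier R \<Longrightarrow> \<psi> (a \<oplus>\<^bsub>R\<^esub> b) = \<psi> a \<oplus>\<^bsub>L1_unit M\<^esub> \<psi> b"
    and hom_neg: "a \<in> carrier R \<Longrightarrow> \<psi> (\<ominus>\<^bsub>R\<^esub> a) = \<ominus>\<^bsub>L1_unit M\<^esub> \<psi> a"
    and hom_zero: "\<psi> \<zero>\<^bsub>R\<^esub> = \<zero>\<^bsub>L1_unit M\<^esub>"
    and hom_scale: "a \<in> carrier R \<Longrightarrow> \<psi> (mv_scale R r a) = mv_scale (L1_unit M) r (\<psi> a)"
    and hom_state: "a \<in> carrier R \<Longrightarrow> s a = L1_state M (\<psi> a)"
    and dense: "F \<in> carrier (L1_unit M) \<Longrightarrow> 0 < \<epsilon> \<Longrightarrow> \<exists>a\<in>carrier R. L1_dist M (\<psi> a) F < \<epsilon>"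
begin

text \<open>The distance is built from operations and state, all preserved by \<open>\<psi>\<close>.
  Being isometric, \<open>\<psi>\<close> lets Cauchy sequences of \<open>R\<close> be studied in the
  metric space \<open>L1\<close>.\<close>

lemma state_dist_hom:
  assumes "a \<in> carrier R" "b \<in> carrier R"
  shows "state_dist R s a b = L1_dist M (\<psi> a) (\<psi> b)"
  using assms
  by (simp add: state_dist_def mv_mult_def hom_state hom_plus hom_neg hom_closed R_plus R_neg)

text \<open>This map will be the isomorphism. Going from \<open>L1_unit M\<close> to the completion,
  it is defined without choosing representatives; real limits in place of \<open>limitin\<close>
  suit the sandwich arguments below.\<close>

definition lim_seqs :: "('x \<Rightarrow> real) set \<Rightarrow> (nat \<Rightarrow> 'a) set"
  where "lim_seqs F = {a. range a \<subseteq> carrier R \<and> (\<lambda>i. L1_dist M (\<psi> (a i)) F) \<longlonglongrightarrow> 0}"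

lemma lim_seqs_carrier: "a \<in> lim_seqs F \<Longrightarrow> a i \<in> carrier R"
  by (auto simp: lim_seqs_def)

lemma lim_seqs_iff_limitin:
  assumes "F \<in> carrier (L1_unit M)" "range a \<subseteq> carrier R"
  shows "a \<in> lim_seqs F \<longleftrightarrow> limitin L1.mtopology (\<psi> \<circ> a) F sequentially"
proof -
  have "\<psi> (a i) \<in> carrier (L1_unit M)" for i
    using assms(2) hom_closed by blast
  then show ?thesis
    using assms by (simp add: lim_seqs_def L1.limitin_metric_dist_null)
qed

lemma cauchy_seqs_iff_MCauchy:
  assumes "range a \<subseteq> carrier R"
  shows "a \<in> cauchy_seqs R s \<longleftrightarrow> L1.MCauchy (\<psi> \<circ> a)"
proof -
  have a: "a i \<in> carrier R" for i
    using assms by blast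
  then have "range (\<psi> \<circ> a) \<subseteq> carrier (L1_unit M)"
    using hom_closed by auto
  with assms show ?thesis
    by (auto simp: cauchy_seqs_def L1.MCauchy_def state_dist_hom a)
qed

text \<open>Density supplies an element within 1/(n+1) of \<open>F\<close> for every
  \<open>n\<close>. Such a sequence serves as representative of the class
  \<open>lim_seqs F\<close>.\<close>

lemma lim_seqs_nonempty:
  assumes "F \<in> carrier (L1_unit M)"
  obtains a where "a \<in> lim_seqs F"
proof -
  have "\<exists>b\<in>carrier R. L1_dist M (\<psi> b) F < inverse (real (Suc n))" for n
    by (rule dense[OF assms]) simp
  then obtain a where a: "\<And>n. a n \<in> carrier R"
    and lt: "\<And>n. L1_dist M (\<psi> (a n)) F < inverse (real (Suc n))"
    by metis
  have "(\<lambda>n. L1_dist M (\<psi> (a n)) F) \<longlonglongrightarrow> 0"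
    by (rule tendsto_sandwich[OF _ _ tendsto_const LIMSEQ_inverse_real_of_nat])
      (use lt less_imp_le in \<open>auto intro!: always_eventually\<close>)
  with a that show thesis by (auto simp: lim_seqs_def)
qed

lemma lim_seqs_subset_cauchy_seqs:
  assumes F: "F \<in> carrier (L1_unit M)" and a: "a \<in> lim_seqs F"
  shows "a \<in> cauchy_seqs R s"
proof -
  have r: "range a \<subseteq> carrier R" using a by (simp add: lim_seqs_def)
  have "limitin L1.mtopology (\<psi> \<circ> a) F sequentially"
    using a by (simp add: lim_seqs_iff_limitin F r)
  moreover have "range (\<psi> \<circ> a) \<subseteq> carrier (L1_unit M)"
    using r hom_closed by auto
  ultimately show ?thesis
    unfolding cauchy_seqs_iff_MCauchy[OF r] by (intro L1.convergent_imp_MCauchy)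
qed

text \<open>Two triangle inequalities: the one through \<open>F\<close> bounds the distance of
  \<open>a i\<close> and \<open>b i\<close>, the one through \<open>\<psi> (a i)\<close> bounds that
  of \<open>\<psi> (b i)\<close> and \<open>F\<close>.\<close>

lemma lim_seqs_dist_null_iff:
  assumes F: "F \<in> carrier (L1_unit M)"
    and a: "a \<in> lim_seqs F" and b: "range b \<subseteq> carrier R"
  shows "b \<in> lim_seqs F \<longleftrightarrow> (\<lambda>i. state_dist R s (a i) (b i)) \<longlonglongrightarrow> 0"
proof -
  have ac: "\<psi> (a i) \<in> carrier (L1_unit M)" and bc: "\<psi> (b i) \<in> carrier (L1_unit M)" for i
    using lim_seqs_carrier[OF a] b hom_closed by blast+
  have eq: "state_dist R s (a i) (b i) = L1_dist M (\<psi> (a i)) (\<psi> (b i))" for i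
    using lim_seqs_carrier[OF a] b by (intro state_dist_hom) auto
  have la: "(\<lambda>i. L1_dist M (\<psi> (a i)) F) \<longlonglongrightarrow> 0"
    using a by (simp add: lim_seqs_def)
  show ?thesis
  proof
    assume "b \<in> lim_seqs F"
    then have lb: "(\<lambda>i. L1_dist M (\<psi> (b i)) F) \<longlonglongrightarrow> 0"
      by (simp add: lim_seqs_def)
    show "(\<lambda>i. state_dist R s (a i) (b i)) \<longlonglongrightarrow> 0"
    proof (rule tendsto_sandwich[OF _ _ tendsto_const tendsto_add_zero[OF la lb]])
      show "\<forall>\<^sub>F i in sequentially. state_dist R s (a i) (b i)
        \<le> L1_dist M (\<psi> (a i)) F + L1_dist M (\<psi> (b i)) F"
        using L1.triangle[OF ac F bc] by (simp add: eq L1.commute)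
    qed (simp add: eq)
  next
    assume l: "(\<lambda>i. state_dist R s (a i) (b i)) \<longlonglongrightarrow> 0"
    have "(\<lambda>i. L1_dist M (\<psi> (b i)) F) \<longlonglongrightarrow> 0"
    proof (rule tendsto_sandwich[OF _ _ tendsto_const tendsto_add_zero[OF l la]])
      show "\<forall>\<^sub>F i in sequentially. L1_dist M (\<psi> (b i)) F
        \<le> state_dist R s (a i) (b i) + L1_dist M (\<psi> (a i)) F"
        using L1.triangle[OF bc ac F] by (simp add: eq L1.commute)
    qed simp
    with b show "b \<in> lim_seqs F" by (simp add: lim_seqs_def)
  qed
qed

text \<open>Having the same limit in L1 amounts to having null distance in \<open>R\<close>.
  Sequences that leave the carrier lie on neither side.\<close>

lemma lim_seqs_eq_cauchy_class:
  assumes F: "F \<in> carrier (L1_unit M)" and a: "a \<in> lim_seqs F"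
  shows "lim_seqs F = cauchy_rel R s `` {a}"
proof -
  have "b \<in> lim_seqs F \<longleftrightarrow> (a, b) \<in> cauchy_rel R s" for b
  proof (cases "range b \<subseteq> carrier R")
    case True
    show ?thesis
      using lim_seqs_dist_null_iff[OF F a True] lim_seqs_subset_cauchy_seqs[OF F]
        a by (auto simp: cauchy_rel_def)
  next
    case False
    then show ?thesis by (auto simp: lim_seqs_def cauchy_rel_def cauchy_seqs_def)
  qed
  then show ?thesis by auto
qed

text \<open>Completeness of L1 enters here; it makes \<open>lim_seqs\<close> surjective onto the
  completion.\<close>

lemma cauchy_seqs_lim:
  assumes "a \<in> cauchy_seqs R s"
  obtains F where "F \<in> carrier (L1_unit M)" "a \<in> lim_seqs F"
proof -
  have r: "range a \<subseteq> carrier R" using assms by (simp add: cauchy_seqs_def)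
  with assms have "L1.MCauchy (\<psi> \<circ> a)" by (simp add: cauchy_seqs_iff_MCauchy)
  then obtain F where F: "limitin L1.mtopology (\<psi> \<circ> a) F sequentially"
    using mcomplete_L1_dist by (auto simp: L1.mcomplete_def)
  then have "F \<in> carrier (L1_unit M)" by (simp add: L1.limitin_metric)
  with F r that show thesis by (simp add: lim_seqs_iff_limitin)
qed

text \<open>Injectivity is uniqueness of limits, applied to a common member of the two sets, which
  exists by density.\<close>

lemma bij_betw_lim_seqs:
  "bij_betw lim_seqs (carrier (L1_unit M)) (cauchy_seqs R s // cauchy_rel R s)"
proof (rule bij_betwI')
  fix F G assume F: "F \<in> carrier (L1_unit M)" and G: "G \<in> carrier (L1_unit M)"
  show "lim_seqs F = lim_seqs G \<longleftrightarrow> F = G"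
  proof
    assume eq: "lim_seqs F = lim_seqs G"
    obtain a where "a \<in> lim_seqs F" using lim_seqs_nonempty[OF F] .
    moreover from this have "range a \<subseteq> carrier R" by (simp add: lim_seqs_def)
    moreover have "a \<in> lim_seqs G" using \<open>a \<in> lim_seqs F\<close> eq by simp
    ultimately show "F = G"
      using F G L1.limitin_metric_unique[of "\<psi> \<circ> a" F sequentially G]
      by (simp add: lim_seqs_iff_limitin)
  qed simp
next
  fix F assume F: "F \<in> carrier (L1_unit M)"
  obtain a where a: "a \<in> lim_seqs F" using lim_seqs_nonempty[OF F] .
  show "lim_seqs F \<in> cauchy_seqs R s // cauchy_rel R s"
    unfolding lim_seqs_eq_cauchy_class[OF F a]
    by (rule quotientI) (rule lim_seqs_subset_cauchy_seqs[OF F a])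
next
  fix X assume "X \<in> cauchy_seqs R s // cauchy_rel R s"
  then obtain a where a: "a \<in> cauchy_seqs R s" and X: "X = cauchy_rel R s `` {a}"
    by (auto elim: quotientE)
  obtain F where "F \<in> carrier (L1_unit M)" "a \<in> lim_seqs F"
    using cauchy_seqs_lim[OF a] .
  then show "\<exists>F\<in>carrier (L1_unit M). X = lim_seqs F"
    using X lim_seqs_eq_cauchy_class by blast
qed

text \<open>The state changes by at most the distance, so it has the same limit along every sequence
  tending to \<open>F\<close>; a member of \<open>lim_seqs F\<close> makes that value
  unique.\<close>

lemma completion_state_lim_seqs:
  assumes F: "F \<in> carrier (L1_unit M)"
  shows "completion_state s (lim_seqs F) = L1_state M F"
proof -
  have lim: "(\<lambda>i. s (a i)) \<longlonglongrightarrow> L1_state M F" if a: "a \<in> lim_seqs F" for a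
  proof (rule LIM_zero_cancel, rule Lim_null_comparison)
    show "(\<lambda>i. L1_dist M (\<psi> (a i)) F) \<longlonglongrightarrow> 0"
      using a by (simp add: lim_seqs_def)
    show "\<forall>\<^sub>F i in sequentially. norm (s (a i) - L1_state M F) \<le> L1_dist M (\<psi> (a i)) F"
      using L1_state_diff_le[OF hom_closed F] lim_seqs_carrier[OF a]
      by (simp add: hom_state)
  qed
  obtain a where "a \<in> lim_seqs F" using lim_seqs_nonempty[OF F] .
  then show ?thesis
    unfolding completion_state_def
    by (intro the_equality) (use lim LIMSEQ_unique in blast)+
qed

text \<open>For each operation, applying it termwise to sequences tending to the arguments gives a
  sequence tending to the result. Hence all classes in the union defining the operation of the
  completion are equal, and the union collapses since \<open>a0\<close> and \<open>b0\<close> show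
  its index sets nonempty.\<close>

lemma normed_isomorphic_norm_completion:
  "normed_isomorphic (L1_unit M) (L1_state M) (norm_completion R s) (completion_state s)"
  unfolding normed_isomorphic_def
proof (intro exI[of _ lim_seqs] conjI ballI allI)
  interpret RMV: riesz_mv_algebra "L1_unit M" by (rule riesz_mv_algebra_L1_unit)
  show "bij_betw lim_seqs (carrier (L1_unit M)) (carrier (norm_completion R s))"
    by (simp add: norm_completion_def bij_betw_lim_seqs)
  have "(\<lambda>i. \<zero>\<^bsub>R\<^esub>) \<in> lim_seqs \<zero>\<^bsub>L1_unit M\<^esub>"
    by (simp add: lim_seqs_def R_zero hom_zero RMV.zero_closed)
  from lim_seqs_eq_cauchy_class[OF RMV.zero_closed this]
  show "lim_seqs \<zero>\<^bsub>L1_unit M\<^esub> = \<zero>\<^bsub>norm_completion R s\<^esub>"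
    by (simp add: norm_completion_def)
  fix F assume F: "F \<in> carrier (L1_unit M)"
  obtain a0 where a0: "a0 \<in> lim_seqs F" using lim_seqs_nonempty[OF F] .
  show "completion_state s (lim_seqs F) = L1_state M F"
    by (rule completion_state_lim_seqs[OF F])
  have "(\<lambda>i. \<ominus>\<^bsub>R\<^esub> (a i)) \<in> lim_seqs (\<ominus>\<^bsub>L1_unit M\<^esub> F)" if "a \<in> lim_seqs F" for a
    using that lim_seqs_carrier[OF that]
    by (auto simp: lim_seqs_def R_neg hom_neg L1_dist_neg hom_closed F)
  then have "lim_seqs (\<ominus>\<^bsub>L1_unit M\<^esub> F) = cauchy_rel R s `` {\<lambda>i. \<ominus>\<^bsub>R\<^esub> (a i)}"
    if "a \<in> lim_seqs F" for a
    using that RMV.neg_closed[OF F] lim_seqs_eq_cauchy_class by blast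
  then show "lim_seqs (\<ominus>\<^bsub>L1_unit M\<^esub> F) = \<ominus>\<^bsub>norm_completion R s\<^esub> lim_seqs F"
    using a0 by (auto simp: norm_completion_def)
  show "lim_seqs (mv_scale (L1_unit M) r F) = mv_scale (norm_completion R s) r (lim_seqs F)" for r
  proof -
    have "(\<lambda>i. mv_scale R r (a i)) \<in> lim_seqs (mv_scale (L1_unit M) r F)"
      if "a \<in> lim_seqs F" for a
      using that lim_seqs_carrier[OF that]
      by (auto simp: lim_seqs_def R_scale hom_scale L1_dist_scale hom_closed F
          intro: tendsto_mult_right_zero)
    then have "lim_seqs (mv_scale (L1_unit M) r F) = cauchy_rel R s `` {\<lambda>i. mv_scale R r (a i)}"
      if "a \<in> lim_seqs F" for a
      using that RMV.scale_closed[OF F] lim_seqs_eq_cauchy_class by blast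
    then show ?thesis
      using a0 by (auto simp: norm_completion_def)
  qed
  fix G assume G: "G \<in> carrier (L1_unit M)"
  obtain b0 where b0: "b0 \<in> lim_seqs G" using lim_seqs_nonempty[OF G] .
  have "(\<lambda>i. a i \<oplus>\<^bsub>R\<^esub> b i) \<in> lim_seqs (F \<oplus>\<^bsub>L1_unit M\<^esub> G)"
    if a: "a \<in> lim_seqs F" and b: "b \<in> lim_seqs G" for a b
  proof -
    have "(\<lambda>i. L1_dist M (\<psi> (a i)) F) \<longlonglongrightarrow> 0" "(\<lambda>i. L1_dist M (\<psi> (b i)) G) \<longlonglongrightarrow> 0"
      using a b by (simp_all add: lim_seqs_def)
    note l = tendsto_add_zero[OF this]
    note cl = lim_seqs_carrier[OF a] lim_seqs_carrier[OF b]
    have "(\<lambda>i. L1_dist M (\<psi> (a i \<oplus>\<^bsub>R\<^esub> b i)) (F \<oplus>\<^bsub>L1_unit M\<^esub> G)) \<longlonglongrightarrow> 0"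
      by (rule tendsto_sandwich[OF _ _ tendsto_const l])
        (use cl in \<open>simp_all add: hom_plus L1_dist_plus_le hom_closed F G\<close>)
    then show ?thesis using cl by (auto simp: lim_seqs_def R_plus)
  qed
  then have eq: "lim_seqs (F \<oplus>\<^bsub>L1_unit M\<^esub> G) = cauchy_rel R s `` {\<lambda>i. a i \<oplus>\<^bsub>R\<^esub> b i}"
    if "a \<in> lim_seqs F" "b \<in> lim_seqs G" for a b
    using that RMV.plus_closed[OF F G] lim_seqs_eq_cauchy_class by blast
  have "lim_seqs F \<oplus>\<^bsub>norm_completion R s\<^esub> lim_seqs G
      = (\<Union>a\<in>lim_seqs F. \<Union>b\<in>lim_seqs G. lim_seqs (F \<oplus>\<^bsub>L1_unit M\<^esub> G))"
    unfolding norm_completion_def riesz_mv.simps by (intro SUP_cong refl eq[symmetric])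
  also have "\<dots> = lim_seqs (F \<oplus>\<^bsub>L1_unit M\<^esub> G)"
    using a0 b0 by auto
  finally show "lim_seqs (F \<oplus>\<^bsub>L1_unit M\<^esub> G) = lim_seqs F \<oplus>\<^bsub>norm_completion R s\<^esub> lim_seqs G"
    by simp
qed

end

section \<open>The L1-closure of an algebra of functions\<close>

text \<open>The sum counts the naturals below \<open>y\<close>, and there are as many as the ceiling
  of \<open>y\<close>; the bound \<open>y \<le> real m\<close> ensures that the count is not cut
  off.\<close>

lemma sum_indicator_less_approx:
  fixes y :: real
  assumes "0 \<le> y" "y \<le> real m"
  shows "\<bar>(\<Sum>k<m. if real k < y then 1 else 0) - y\<bar> \<le> 1"
proof -
  have "k < nat \<lceil>y\<rceil> \<longleftrightarrow> real k < y" for k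
    by (simp add: zless_nat_eq_int_zless less_ceiling_iff)
  moreover have "k < m" if "real k < y" for k
    using that assms(2) by linarith
  ultimately have "{..<m} \<inter> {k. real k < y} = {..<nat \<lceil>y\<rceil>}" by blast
  then have "(\<Sum>k<m. if real k < y then 1 else (0::real)) = real (nat \<lceil>y\<rceil>)"
    by (simp add: sum.If_cases)
  then show ?thesis using assms by linarith
qed

text \<open>\<open>T\<close> consists of functions, not classes, because the density argument speaks
  of superlevel sets. It will be the set of term functions.\<close>

locale function_algebra = finite_measure M for M :: "'x measure" +
  fixes T :: "('x \<Rightarrow> real) set"
  assumes T_unit_integrable: "T \<subseteq> unit_integrable M"
    and T_nonempty: "T \<noteq> {}"
    and T_plus: "f \<in> T \<Longrightarrow> g \<in> T \<Longrightarrow> (\<lambda>x. min 1 (f x + g x)) \<in> T"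
    and T_neg: "f \<in> T \<Longrightarrow> (\<lambda>x. 1 - f x) \<in> T"
    and T_scale: "f \<in> T \<Longrightarrow> (\<lambda>x. of_unit r * f x) \<in> T"
begin

definition L1_closure :: "('x \<Rightarrow> real) set"
  where "L1_closure =
    {f \<in> unit_integrable M. \<forall>\<epsilon>>0. \<exists>t\<in>T. (\<integral>x. \<bar>t x - f x\<bar> \<partial>M) < \<epsilon>}"

lemma L1_closure_unit_integrable: "f \<in> L1_closure \<Longrightarrow> f \<in> unit_integrable M"
  by (simp add: L1_closure_def)

lemma L1_closureE:
  assumes "f \<in> L1_closure" "0 < \<epsilon>"
  obtains t where "t \<in> T" "t \<in> unit_integrable M" "(\<integral>x. \<bar>t x - f x\<bar> \<partial>M) < \<epsilon>"
proof -
  obtain t where "t \<in> T" "(\<integral>x. \<bar>t x - f x\<bar> \<partial>M) < \<epsilon>"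
    using assms by (auto simp: L1_closure_def)
  with T_unit_integrable show thesis by (intro that) auto
qed

lemma T_subset_L1_closure: "T \<subseteq> L1_closure"
proof
  fix f assume "f \<in> T"
  moreover from this have "f \<in> unit_integrable M" using T_unit_integrable by blast
  moreover have "\<exists>t\<in>T. (\<integral>x. \<bar>t x - f x\<bar> \<partial>M) < \<epsilon>" if "0 < \<epsilon>" for \<epsilon> :: real
    by (rule bexI[of _ f]) (use that \<open>f \<in> T\<close> in simp_all)
  ultimately show "f \<in> L1_closure" by (simp add: L1_closure_def)
qed

text \<open>By dominated convergence some \<open>g n\<close> is within half the tolerance of
  \<open>f\<close>, and an element of \<open>T\<close> is within the other half of
  \<open>g n\<close>.\<close>

lemma L1_closure_lim:
  assumes g: "\<And>n. g n \<in> L1_closure" and f: "f \<in> unit_integrable M"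
    and lim: "AE x in M. (\<lambda>n. g n x) \<longlonglongrightarrow> f x"
  shows "f \<in> L1_closure"
  unfolding L1_closure_def
proof (intro CollectI conjI allI impI f)
  fix \<epsilon> :: real assume "0 < \<epsilon>"
  note gU = g[THEN L1_closure_unit_integrable]
  have "\<forall>\<^sub>F n in sequentially. (\<integral>x. \<bar>g n x - f x\<bar> \<partial>M) < \<epsilon> / 2"
    by (rule order_tendstoD(2)[OF integral_abs_diff_tendsto_0[OF gU f lim] half_gt_zero[OF \<open>0 < \<epsilon>\<close>]])
  then obtain n where n: "(\<integral>x. \<bar>g n x - f x\<bar> \<partial>M) < \<epsilon> / 2"
    using eventually_happens'[OF sequentially_bot] by blast
  obtain t where t: "t \<in> T" "t \<in> unit_integrable M" "(\<integral>x. \<bar>t x - g n x\<bar> \<partial>M) < \<epsilon> / 2"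
    using L1_closureE[OF g half_gt_zero[OF \<open>0 < \<epsilon>\<close>]] .
  have "(\<integral>x. \<bar>t x - f x\<bar> \<partial>M) < \<epsilon>"
    using integral_abs_diff_triangle[OF t(2) gU f, of n] n t(3) by simp
  with t(1) show "\<exists>t\<in>T. (\<integral>x. \<bar>t x - f x\<bar> \<partial>M) < \<epsilon>" by blast
qed

lemma L1_closure_AE_cong:
  assumes "g \<in> L1_closure" "f \<in> unit_integrable M" "AE x in M. g x = f x"
  shows "f \<in> L1_closure"
  by (rule L1_closure_lim[of "\<lambda>_. g", OF assms(1,2)]) (use assms(3) in eventually_elim, simp)

lemma L1_closure_plus:
  assumes f: "f \<in> L1_closure" and g: "g \<in> L1_closure"
  shows "(\<lambda>x. min 1 (f x + g x)) \<in> L1_closure"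
  unfolding L1_closure_def
proof (intro CollectI conjI allI impI)
  note fU = L1_closure_unit_integrable[OF f] and gU = L1_closure_unit_integrable[OF g]
  show "(\<lambda>x. min 1 (f x + g x)) \<in> unit_integrable M"
    using fU gU by (rule unit_integrable_plus)
  fix \<epsilon> :: real assume "0 < \<epsilon>"
  obtain t where t: "t \<in> T" "t \<in> unit_integrable M" "(\<integral>x. \<bar>t x - f x\<bar> \<partial>M) < \<epsilon> / 2"
    using L1_closureE[OF f half_gt_zero[OF \<open>0 < \<epsilon>\<close>]] .
  obtain u where u: "u \<in> T" "u \<in> unit_integrable M" "(\<integral>x. \<bar>u x - g x\<bar> \<partial>M) < \<epsilon> / 2"
    using L1_closureE[OF g half_gt_zero[OF \<open>0 < \<epsilon>\<close>]] .
  have "(\<integral>x. \<bar>min 1 (t x + u x) - min 1 (f x + g x)\<bar> \<partial>M)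
    \<le> (\<integral>x. \<bar>t x - f x\<bar> \<partial>M) + (\<integral>x. \<bar>u x - g x\<bar> \<partial>M)"
    \<comment> \<open>The Lipschitz bound for the truncated sum is read off from its version on
      classes.\<close>
    using L1_dist_plus_le[of "ae_class M t" "ae_class M f" "ae_class M u" "ae_class M g"]
      t(2) u(2) fU gU
    by (simp add: L1_unit_plus L1_dist_ae_class unit_integrable_plus ae_class_in_carrier)
  then have "(\<integral>x. \<bar>min 1 (t x + u x) - min 1 (f x + g x)\<bar> \<partial>M) < \<epsilon>"
    using t(3) u(3) by simp
  then show "\<exists>t\<in>T. (\<integral>x. \<bar>t x - min 1 (f x + g x)\<bar> \<partial>M) < \<epsilon>"
    by (rule bexI[of _ "\<lambda>x. min 1 (t x + u x)"]) (rule T_plus[OF t(1) u(1)])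
qed

lemma L1_closure_neg:
  assumes f: "f \<in> L1_closure"
  shows "(\<lambda>x. 1 - f x) \<in> L1_closure"
  unfolding L1_closure_def
proof (intro CollectI conjI allI impI)
  show "(\<lambda>x. 1 - f x) \<in> unit_integrable M"
    using f by (intro unit_integrable_neg L1_closure_unit_integrable)
  fix \<epsilon> :: real assume "0 < \<epsilon>"
  obtain t where t: "t \<in> T" "(\<integral>x. \<bar>t x - f x\<bar> \<partial>M) < \<epsilon>"
    using L1_closureE[OF f \<open>0 < \<epsilon>\<close>] .
  have "\<bar>1 - t x - (1 - f x)\<bar> = \<bar>t x - f x\<bar>" for x by simp
  with t(2) have "(\<integral>x. \<bar>1 - t x - (1 - f x)\<bar> \<partial>M) < \<epsilon>" by simp
  then show "\<exists>t\<in>T. (\<integral>x. \<bar>t x - (1 - f x)\<bar> \<partial>M) < \<epsilon>"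
    by (rule bexI[of _ "\<lambda>x. 1 - t x"]) (rule T_neg[OF t(1)])
qed

lemma L1_closure_scale:
  assumes f: "f \<in> L1_closure" and r: "0 \<le> r" "r \<le> 1"
  shows "(\<lambda>x. r * f x) \<in> L1_closure"
  unfolding L1_closure_def
proof (intro CollectI conjI allI impI)
  have r': "of_unit (Abs_unit r) = r"
    using r by (simp add: Abs_unit_inverse)
  show "(\<lambda>x. r * f x) \<in> unit_integrable M"
    using unit_integrable_scale[OF L1_closure_unit_integrable[OF f], of "Abs_unit r"]
    by (simp add: r')
  fix \<epsilon> :: real assume "0 < \<epsilon>"
  obtain t where t: "t \<in> T" "(\<integral>x. \<bar>t x - f x\<bar> \<partial>M) < \<epsilon>"
    using L1_closureE[OF f \<open>0 < \<epsilon>\<close>] .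
  have "(\<integral>x. \<bar>r * t x - r * f x\<bar> \<partial>M) = r * (\<integral>x. \<bar>t x - f x\<bar> \<partial>M)"
    using r by (simp add: abs_mult flip: right_diff_distrib)
  also have "\<dots> \<le> (\<integral>x. \<bar>t x - f x\<bar> \<partial>M)"
    using r by (intro mult_left_le_one_le) simp_all
  finally have "(\<integral>x. \<bar>r * t x - r * f x\<bar> \<partial>M) < \<epsilon>" using t(2) by simp
  then show "\<exists>t\<in>T. (\<integral>x. \<bar>t x - r * f x\<bar> \<partial>M) < \<epsilon>"
    by (rule bexI[of _ "\<lambda>x. r * t x"]) (use T_scale[OF t(1), of "Abs_unit r"] in \<open>simp add: r'\<close>)
qed

lemma L1_closure_zero: "(\<lambda>x. 0) \<in> L1_closure"
proof -
  obtain t where "t \<in> T" using T_nonempty by blast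
  then have "(\<lambda>x. 0 * t x) \<in> L1_closure"
    using T_subset_L1_closure by (intro L1_closure_scale) auto
  then show ?thesis by simp
qed

lemma L1_closure_const:
  assumes "0 \<le> c" "c \<le> 1"
  shows "(\<lambda>x. c) \<in> L1_closure"
proof -
  have "(\<lambda>x. c * (1 - 0)) \<in> L1_closure"
    by (intro L1_closure_scale L1_closure_neg L1_closure_zero assms)
  then show ?thesis by simp
qed

lemma L1_closure_mult:
  assumes "f \<in> L1_closure" "g \<in> L1_closure"
  shows "(\<lambda>x. max 0 (f x + g x - 1)) \<in> L1_closure"
proof -
  have "(\<lambda>x. 1 - min 1 ((1 - f x) + (1 - g x))) \<in> L1_closure"
    by (intro L1_closure_neg L1_closure_plus assms)
  also have "(\<lambda>x. 1 - min 1 ((1 - f x) + (1 - g x))) = (\<lambda>x. max 0 (f x + g x - 1))"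
    by (auto simp: fun_eq_iff)
  finally show ?thesis .
qed

section \<open>The sigma-algebra of sets whose indicator lies in the closure\<close>

definition closure_sets :: "'x set set"
  where "closure_sets = {A \<in> sets M. indicator A \<in> L1_closure}"

lemma unit_integrable_indicator: "A \<in> sets M \<Longrightarrow> indicator A \<in> unit_integrable M"
  by (simp add: unit_integrable_iff indicator_def)

lemma closure_sets_empty: "{} \<in> closure_sets"
proof -
  have "(indicator {} :: 'x \<Rightarrow> real) = (\<lambda>x. 0)" by (simp add: fun_eq_iff)
  then show ?thesis using L1_closure_zero by (simp add: closure_sets_def)
qed

lemma closure_sets_compl:
  assumes "A \<in> closure_sets"
  shows "space M - A \<in> closure_sets"
proof -
  have A: "A \<in> sets M" "(\<lambda>x. 1 - indicator A x) \<in> L1_closure"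
    using assms by (simp_all add: closure_sets_def L1_closure_neg)
  have "indicator (space M - A) \<in> L1_closure"
  proof (rule L1_closure_AE_cong[OF A(2)])
    show "AE x in M. 1 - indicator A x = (indicator (space M - A) x :: real)"
      by (rule AE_I2) (simp add: indicator_def)
  qed (use A in \<open>auto intro: unit_integrable_indicator\<close>)
  with A(1) show ?thesis by (auto simp: closure_sets_def)
qed

lemma closure_sets_Un:
  assumes "A \<in> closure_sets" "B \<in> closure_sets"
  shows "A \<union> B \<in> closure_sets"
proof -
  have "(\<lambda>x. min 1 (indicator A x + indicator B x)) \<in> L1_closure"
    using assms by (intro L1_closure_plus) (simp_all add: closure_sets_def)
  also have "(\<lambda>x. min 1 (indicator A x + indicator B x)) = (indicator (A \<union> B) :: _ \<Rightarrow> real)"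
    by (auto simp: fun_eq_iff indicator_def)
  finally show ?thesis using assms by (auto simp: closure_sets_def)
qed

text \<open>Finite unions are handled by induction, and their indicators converge pointwise to the
  indicator of the whole union.\<close>

lemma closure_sets_countable_Union:
  fixes A :: "nat \<Rightarrow> 'x set"
  assumes A: "\<And>i. A i \<in> closure_sets"
  shows "(\<Union>i. A i) \<in> closure_sets"
proof -
  have "(\<Union>i<n. A i) \<in> closure_sets" for n
    by (induction n) (simp_all add: closure_sets_empty lessThan_Suc closure_sets_Un A)
  then have fin: "(indicator (\<Union>i<n. A i) :: _ \<Rightarrow> real) \<in> L1_closure" for n
    by (simp add: closure_sets_def)
  have meas: "(\<Union>i. A i) \<in> sets M"
    using A by (auto simp: closure_sets_def)
  have "indicator (\<Union>i. A i) \<in> L1_closure"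
    by (rule L1_closure_lim[OF fin unit_integrable_indicator[OF meas]])
      (rule AE_I2, rule LIMSEQ_indicator_UN)
  with meas show ?thesis by (simp add: closure_sets_def)
qed

text \<open>Multiples of the positive part of \<open>f - c\<close>, truncated at 1, tend to the
  indicator of the set. For \<open>c\<close> outside [0,1] the set is empty or the whole
  space.\<close>

lemma superlevel_in_closure_sets:
  assumes f: "f \<in> L1_closure"
  shows "{x \<in> space M. c < f x} \<in> closure_sets"
proof -
  note fU = L1_closure_unit_integrable[OF f]
  consider "c < 0" | "0 \<le> c" "c \<le> 1" | "1 < c" by linarith
  then show ?thesis
  proof cases
    case 1
    then have "{x \<in> space M. c < f x} = space M - {}"
      using unit_integrable_bounds(1)[OF fU] by force
    then show ?thesis by (simp only: closure_sets_compl[OF closure_sets_empty])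
  next
    case 3
    then have "{x \<in> space M. c < f x} = {}"
      using unit_integrable_bounds(2)[OF fU] by force
    then show ?thesis by (simp only: closure_sets_empty)
  next
    case 2
    define d where "d x = max 0 (f x - c)" for x
    \<comment> \<open>The positive part of \<open>f - c\<close> is the MV-product of
      \<open>f\<close> with the constant \<open>1 - c\<close>, which lies in [0,1] in this
      case.\<close>
    have "(\<lambda>x. max 0 (f x + (1 - c) - 1)) \<in> L1_closure"
      using 2 by (intro L1_closure_mult L1_closure_const f) auto
    then have d: "d \<in> L1_closure" by (simp add: d_def[abs_def])
    \<comment> \<open>Lets the truncated multiples be built by repeated truncated addition of
      \<open>d\<close>.\<close>
    have min_min_add: "min 1 (min 1 p + q) = min 1 (p + q)" if "0 \<le> q" for p q :: real
      using that by (simp add: min_def)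
    have g: "(\<lambda>x. min 1 (real n * d x)) \<in> L1_closure" for n
    proof (induction n)
      case 0
      then show ?case by (simp add: L1_closure_zero)
    next
      case (Suc n)
      have "min 1 (min 1 (real n * d x) + d x) = min 1 (real (Suc n) * d x)" for x
        using min_min_add[of "d x" "real n * d x"] by (simp add: d_def distrib_right add.commute)
      with L1_closure_plus[OF Suc d] show ?case by simp
    qed
    have meas: "{x \<in> space M. c < f x} \<in> sets M"
      using unit_integrable_measurable[OF fU] by measurable
    have "indicator {x \<in> space M. c < f x} \<in> L1_closure"
    proof (rule L1_closure_lim[OF g unit_integrable_indicator[OF meas]], rule AE_I2)
      fix x assume x: "x \<in> space M"
      show "(\<lambda>n. min 1 (real n * d x)) \<longlonglongrightarrow> indicator {x \<in> space M. c < f x} x"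
      proof (cases "c < f x")
        case True
        then have "0 < d x" by (simp add: d_def)
        then obtain N where N: "1 < real N * d x"
          using reals_Archimedean3 by blast
        have "\<forall>\<^sub>F n in sequentially. min 1 (real n * d x) = 1"
          using eventually_ge_at_top[of N]
        proof eventually_elim
          fix n assume "N \<le> n"
          then have "real N * d x \<le> real n * d x"
            using \<open>0 < d x\<close> by simp
          with N show "min 1 (real n * d x) = 1" by simp
        qed
        then show ?thesis using x True by (simp add: tendsto_eventually)
      qed (simp add: d_def)
    qed
    with meas show ?thesis by (simp add: closure_sets_def)
  qed
qed

text \<open>A layer-cake approximation: the mean of the indicators of the superlevel sets at heights
  k/m, for k < m, differs from \<open>f\<close> by at most 1/m.\<close>

lemma in_L1_closure_of_superlevels:
  assumes f: "f \<in> unit_integrable M" and level: "\<And>c. {x \<in> space M. c < f x} \<in> closure_sets"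
  shows "f \<in> L1_closure"
proof -
  define A where "A m k = {x \<in> space M. real k / real m < f x}" for m k :: nat
  \<comment> \<open>The number \<open>j\<close> of layers is separate from their thickness 1/m, so
    that the induction can add layers with \<open>m\<close> fixed.\<close>
  define g where "g m j x = (\<Sum>k<j. 1 / real m * indicator (A m k) x)" for m j :: nat and x
  have g: "g m j \<in> L1_closure" if "j \<le> m" "0 < m" for m j
    using that(1)
  proof (induction j)
    case 0
    then show ?case by (simp add: g_def[abs_def] L1_closure_zero)
  next
    case (Suc j)
    \<comment> \<open>At most \<open>m\<close> layers of height 1/m never exceed 1, so ordinary
      addition of a layer agrees with the truncated sum.\<close>
    have "g m (Suc j) x \<le> (\<Sum>k<Suc j. 1 / real m)" for x
      unfolding g_def by (intro sum_mono) (auto simp: indicator_def)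
    also have "(\<Sum>k<Suc j. 1 / real m) \<le> 1"
      using Suc.prems \<open>0 < m\<close> by (simp add: field_simps)
    finally have "g m (Suc j) x = min 1 (g m j x + 1 / real m * indicator (A m j) x)" for x
      by (simp add: g_def)
    then have "g m (Suc j) = (\<lambda>x. min 1 (g m j x + 1 / real m * indicator (A m j) x))"
      by blast
    moreover have "(\<lambda>x. 1 / real m * indicator (A m j) x) \<in> L1_closure"
      using level \<open>0 < m\<close>
      by (intro L1_closure_scale) (simp_all add: A_def closure_sets_def)
    ultimately show ?case using L1_closure_plus Suc by simp
  qed
  have close: "\<bar>g m m x - f x\<bar> \<le> 1 / real m" if m: "0 < m" and x: "x \<in> space M" for m x
  proof -
    have y: "0 \<le> real m * f x" "real m * f x \<le> real m"
      using unit_integrable_bounds[OF f x] m by (simp_all add: mult_left_le)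
    have "real m * g m m x = (\<Sum>k<m. if real k < real m * f x then 1 else 0)"
      unfolding g_def sum_distrib_left using m x
      by (intro sum.cong) (auto simp: A_def indicator_def field_simps)
    then have "\<bar>real m * g m m x - real m * f x\<bar> \<le> 1"
      using sum_indicator_less_approx[OF y] by simp
    then have "real m * \<bar>g m m x - f x\<bar> \<le> 1"
      by (simp add: abs_mult flip: right_diff_distrib)
    with m show ?thesis by (simp add: field_simps)
  qed
  show ?thesis
  proof (rule L1_closure_lim[OF _ f AE_I2])
    \<comment> \<open>The index is shifted because the layers require \<open>m\<close> to be
      positive.\<close>
    show "g (Suc n) (Suc n) \<in> L1_closure" for n by (rule g) simp_all
    fix x assume x: "x \<in> space M"
    show "(\<lambda>n. g (Suc n) (Suc n) x) \<longlonglongrightarrow> f x"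
    proof (rule LIM_zero_cancel, rule Lim_null_comparison)
      show "\<forall>\<^sub>F n in sequentially. norm (g (Suc n) (Suc n) x - f x) \<le> 1 / real (Suc n)"
        using close[OF zero_less_Suc x] by (intro always_eventually) simp
      show "(\<lambda>n. 1 / real (Suc n)) \<longlonglongrightarrow> 0"
        by (rule lim_1_over_real_power[of 1, simplified, THEN LIMSEQ_Suc])
    qed
  qed
qed

end

section \<open>Term functions on the unit cube\<close>

lemma space_cube_measure: "space cube_measure = cbox 0 1"
  by (simp add: cube_measure_def space_restrict_space)

text \<open>Completing a measure does not change which properties hold almost everywhere, so
  Lebesgue measure can be exchanged for \<open>lborel\<close>.\<close>

lemma AE_cube_measure_iff:
  fixes P :: "real ^ 'n \<Rightarrow> bool"
  shows "(AE x in cube_measure. P x) \<longleftrightarrow> (AE x in lborel. x \<in> cbox 0 1 \<longrightarrow> P x)"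
  unfolding cube_measure_def by (subst AE_restrict_space_iff) (simp_all add: AE_completion_iff)

lemma prob_space_cube_measure: "prob_space (cube_measure :: (real ^ 'n) measure)"
proof (rule prob_spaceI)
  have "measure lborel (cbox 0 (1 :: real ^ 'n)) = 1"
    by (subst content_cbox_cart) (simp_all add: interval_ne_empty_cart)
  moreover have "emeasure lborel (cbox 0 (1 :: real ^ 'n)) \<noteq> top"
    using emeasure_lborel_cbox_finite[of 0 "1 :: real ^ 'n"] by (simp add: less_top)
  ultimately have "emeasure lborel (cbox 0 (1 :: real ^ 'n)) = 1"
    by (simp add: emeasure_eq_ennreal_measure)
  then show "emeasure (cube_measure :: (real ^ 'n) measure) (space cube_measure) = 1"
    unfolding space_cube_measure unfolding cube_measure_def
    by (simp add: emeasure_restrict_space)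
qed

lemma borel_measurable_cube_measure:
  "f \<in> borel_measurable borel \<Longrightarrow> f \<in> borel_measurable cube_measure"
  unfolding cube_measure_def
  by (intro measurable_restrict_space1 measurable_completion) simp

interpretation cube: prob_space cube_measure
  by (rule prob_space_cube_measure)

section \<open>Term functions and their density\<close>

lemma term_fun_borel_measurable: "term_fun a \<in> borel_measurable borel"
proof (induction a)
  case (Var i)
  have "continuous_on UNIV (\<lambda>x :: real ^ 'a. x $ i)"
    by (intro continuous_intros)
  then show ?case by (simp add: borel_measurable_continuous_onI)
qed simp_all

lemma term_fun_unit_integrable: "term_fun a \<in> unit_integrable cube_measure"
  using term_fun_bounds
  by (auto simp: cube.unit_integrable_iff space_cube_measure
      intro!: borel_measurable_cube_measure term_fun_borel_measurable)

text \<open>This and the next two identities match the formulas behind the Lindenbaum operations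
  with the operations on functions. They hold off the cube too, so the range of
  \<open>term_fun\<close> is itself closed.\<close>

lemma term_fun_plus: "term_fun (Imp (Neg a) b) = (\<lambda>x. min 1 (term_fun a x + term_fun b x))"
  by (simp add: fun_eq_iff)

lemma term_fun_neg: "term_fun (Neg a) = (\<lambda>x. 1 - term_fun a x)"
  by (simp add: fun_eq_iff)

lemma term_fun_scale: "term_fun (Neg (Nabla r (Neg a))) = (\<lambda>x. of_unit r * term_fun a x)"
  by (simp add: fun_eq_iff)

interpretation term_funs: function_algebra cube_measure "range (term_fun :: 'n form \<Rightarrow> real ^ 'n \<Rightarrow> real)"
proof
  fix f g :: "real ^ 'n \<Rightarrow> real" and r
  assume "f \<in> range term_fun"
  then obtain a where f: "f = term_fun a" by blast
  show "(\<lambda>x. 1 - f x) \<in> range term_fun"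
    unfolding f term_fun_neg[symmetric] by (rule rangeI)
  show "(\<lambda>x. of_unit r * f x) \<in> range term_fun"
    unfolding f term_fun_scale[symmetric] by (rule rangeI)
  assume "g \<in> range term_fun"
  then obtain b where g: "g = term_fun b" by blast
  show "(\<lambda>x. min 1 (f x + g x)) \<in> range term_fun"
    unfolding f g term_fun_plus[symmetric] by (rule rangeI)
qed (auto intro: term_fun_unit_integrable)

text \<open>Coordinate half-spaces, cut to the cube, are superlevel sets of variables. They generate
  the Borel sets, and the closure properties of \<open>closure_sets\<close> carry the
  induction.\<close>

lemma borel_in_closure_sets:
  assumes "B \<in> sets (borel :: (real ^ 'n) measure)"
  shows "B \<inter> cbox 0 1 \<in> term_funs.closure_sets"
proof -
  have "B \<in> sigma_sets UNIV ((\<lambda>(a, i). {x :: real ^ 'n. a < x \<bullet> i}) ` (UNIV \<times> Basis))"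
    using assms unfolding borel_eq_halfspace_greater by simp
  then show ?thesis
  proof induction
    case (Basic B)
    \<comment> \<open>The basis vectors of \<open>real ^ 'n\<close> are the unit axes, so the inner
      product with one of them is a coordinate.\<close>
    then obtain c i where B: "B = {x :: real ^ 'n. c < x $ i}"
      by (auto simp: Basis_vec_def inner_axis)
    have "{x \<in> space cube_measure. c < term_fun (Var i) x} \<in> term_funs.closure_sets"
      using term_funs.T_subset_L1_closure by (intro term_funs.superlevel_in_closure_sets) blast
    also have "{x \<in> space cube_measure. c < term_fun (Var i) x} = B \<inter> cbox 0 1"
      by (auto simp: B space_cube_measure)
    finally show ?case .
  next
    case Empty
    then show ?case by (simp add: term_funs.closure_sets_empty)
  next
    case (Compl B)
    then have "space cube_measure - B \<inter> cbox 0 1 \<in> term_funs.closure_sets"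
      by (intro term_funs.closure_sets_compl)
    moreover have "space cube_measure - B \<inter> cbox 0 1 = (UNIV - B) \<inter> cbox 0 1"
      by (auto simp: space_cube_measure)
    ultimately show ?case by simp
  next
    case (Union B)
    then show ?case
      using term_funs.closure_sets_countable_Union[of "\<lambda>i. B i \<inter> cbox 0 1"] by simp
  qed
qed

text \<open>The extension of \<open>f\<close> by 0 is Lebesgue measurable and so agrees almost
  everywhere with a Borel function; clamping restores the bounds. This bridges the gap to
  \<open>borel_in_closure_sets\<close>, which covers Borel sets only.\<close>

lemma unit_integrable_AE_borel:
  assumes f: "f \<in> unit_integrable (cube_measure :: (real ^ 'n) measure)"
  obtains g where "g \<in> borel_measurable borel" "\<And>x. 0 \<le> g x" "\<And>x. g x \<le> 1"
    "AE x in cube_measure. g x = f x"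
proof -
  have "f \<in> borel_measurable (lebesgue_on (cbox 0 1))"
    using cube.unit_integrable_measurable[OF f] by (simp add: cube_measure_def)
  then have "(\<lambda>x. if x \<in> cbox 0 1 then f x else 0) \<in> borel_measurable lebesgue"
    by (intro borel_measurable_if_I) auto
  then obtain h where h: "h \<in> borel_measurable lborel"
    and AE_h: "AE x in lborel. (if x \<in> cbox 0 1 then f x else 0) = h x"
    using completion_ex_borel_measurable_real by blast
  have "AE x in lborel. x \<in> cbox 0 1 \<longrightarrow> max 0 (min 1 (h x)) = f x"
    using AE_h
  proof eventually_elim
    case (elim x)
    show ?case
    proof
      assume x: "x \<in> cbox 0 1"
      then have "0 \<le> f x" "f x \<le> 1"
        using cube.unit_integrable_bounds[OF f] by (simp_all add: space_cube_measure)
      with elim x show "max 0 (min 1 (h x)) = f x" by simp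
    qed
  qed
  then show thesis
    using h by (intro that[of "\<lambda>x. max 0 (min 1 (h x))"]) (simp_all add: AE_cube_measure_iff)
qed

text \<open>A Borel version of \<open>f\<close> has superlevel sets in \<open>closure_sets\<close>,
  and the closure is insensitive to changes on null sets.\<close>

lemma L1_closure_term_funs: "term_funs.L1_closure = unit_integrable cube_measure"
proof (intro equalityI subsetI)
  fix f :: "real ^ 'n \<Rightarrow> real" assume f: "f \<in> unit_integrable cube_measure"
  obtain g :: "real ^ 'n \<Rightarrow> real"
    where g: "g \<in> borel_measurable borel" "\<And>x. 0 \<le> g x" "\<And>x. g x \<le> 1"
    and AE_g: "AE x in cube_measure. g x = f x"
    using unit_integrable_AE_borel[OF f] by blast
  have "g \<in> term_funs.L1_closure"
  proof (rule term_funs.in_L1_closure_of_superlevels)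
    show "g \<in> unit_integrable cube_measure"
      using g by (simp add: cube.unit_integrable_iff borel_measurable_cube_measure)
    fix c
    have "{x. c < g x} \<in> sets borel"
      using g(1) by measurable
    from borel_in_closure_sets[OF this]
    show "{x \<in> space cube_measure. c < g x} \<in> term_funs.closure_sets"
      by (simp add: space_cube_measure Int_def conj_commute)
  qed
  then show "f \<in> term_funs.L1_closure"
    by (rule term_funs.L1_closure_AE_cong[OF _ f AE_g])
qed (rule term_funs.L1_closure_unit_integrable)

text \<open>Well-definedness is soundness of the logic: equiprovable formulas have equal term
  functions on the cube, which is the whole space of \<open>cube_measure\<close>.\<close>

lift_definition lindenbaum_class :: "('n::finite) lindenbaum \<Rightarrow> (real ^ 'n \<Rightarrow> real) set"
  is "\<lambda>a. ae_class cube_measure (term_fun a)"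
  by (rule cube.ae_class_cong)
    (auto simp: space_cube_measure intro: term_fun_unit_integrable equiprovable_term_fun)

interpretation RL: dense_L1_hom cube_measure "RL :: ('n::finite) lindenbaum riesz_mv" RL_state lindenbaum_class
proof
  fix a b :: "('n::finite) lindenbaum" and r
  note calc = cube.L1_unit_simps term_fun_unit_integrable
  show "lindenbaum_class a \<in> riesz_mv.carrier (L1_unit cube_measure)"
    by transfer (simp add: cube.ae_class_in_carrier term_fun_unit_integrable)
  show "lindenbaum_class (a \<oplus>\<^bsub>RL\<^esub> b) =
    lindenbaum_class a \<oplus>\<^bsub>L1_unit cube_measure\<^esub> lindenbaum_class b"
    unfolding RL_def riesz_mv.simps
    by transfer (simp only: calc term_fun_plus)
  show "lindenbaum_class (\<ominus>\<^bsub>RL\<^esub> a) = \<ominus>\<^bsub>L1_unit cube_measure\<^esub> lindenbaum_class a"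
    unfolding RL_def riesz_mv.simps
    by transfer (simp only: calc term_fun_neg)
  show "lindenbaum_class (mv_scale RL r a) = mv_scale (L1_unit cube_measure) r (lindenbaum_class a)"
    unfolding RL_def riesz_mv.simps
    by transfer (simp only: calc term_fun_scale)
  show "RL_state a = L1_state cube_measure (lindenbaum_class a)"
    by transfer (simp add: cube.L1_state_ae_class term_fun_unit_integrable)
next
  \<comment> \<open>\<open>lind_zero\<close> is represented by the negation of an implication
    \<open>p\<close> to \<open>p\<close>, whose term function is constantly 0.\<close>
  show "lindenbaum_class \<zero>\<^bsub>RL :: 'n lindenbaum riesz_mv\<^esub> = \<zero>\<^bsub>L1_unit cube_measure\<^esub>"
    unfolding RL_def riesz_mv.simps
    by transfer (simp add: cube.L1_unit_zero term_fun_neg[abs_def])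
next
  fix F :: "(real ^ 'n \<Rightarrow> real) set" and \<epsilon> :: real
  assume "F \<in> riesz_mv.carrier (L1_unit cube_measure)" and "0 < \<epsilon>"
  then obtain f where f: "f \<in> unit_integrable cube_measure" and F: "F = ae_class cube_measure f"
    by (auto elim: cube.L1_unit_cases)
  \<comment> \<open>Density of the image is the fact that the closure of the term functions is
    everything.\<close>
  then have "f \<in> term_funs.L1_closure" by (simp add: L1_closure_term_funs)
  from term_funs.L1_closureE[OF this \<open>0 < \<epsilon>\<close>]
  obtain a where "(\<integral>x. \<bar>term_fun a x - f x\<bar> \<partial>cube_measure) < \<epsilon>" by blast
  then have "L1_dist cube_measure (lindenbaum_class (abs_lindenbaum a)) F < \<epsilon>"
    by (simp add: F lindenbaum_class.abs_eq cube.L1_dist_ae_class f term_fun_unit_integrable)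
  then show "\<exists>a\<in>riesz_mv.carrier RL. L1_dist cube_measure (lindenbaum_class a) F < \<epsilon>"
    by (auto simp: RL_def)
qed (simp_all add: RL_def)

theorem theorem2p18:
  fixes \<mu> :: "(real ^ 'n) measure"
  assumes "\<mu> = cube_measure"
  shows "riesz_mv_algebra (L1_unit \<mu>)
    \<and> mv_state (L1_unit \<mu>) (L1_state \<mu>)
    \<and> state_complete (L1_unit \<mu>) (L1_state \<mu>)
    \<and> normed_isomorphic
        (L1_unit \<mu>) (L1_state \<mu>)
        (norm_completion (RL :: 'n lindenbaum riesz_mv) RL_state) (completion_state RL_state)"
  unfolding assms
  using cube.riesz_mv_algebra_L1_unit cube.mv_state_L1_unit cube.state_complete_L1_unit
    RL.normed_isomorphic_norm_completion
  by blast

end
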